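(* Fix $0<d<1$. For every nonempty open set $\Omega\subset[0,2\pi]$ there exists a set $\Gamma\subset\mathbb{Z}$ of uniform density $D(\Gamma)>(1-d)|\Omega|$ such that \[ C(d)\,|\Omega|\sum_{\gamma\in\Gamma}|a_\gamma|^2\le \Big\|\sum_{\gamma\in\Gamma}a_\gamma e^{i\gamma t}\Big\|_{L^2(\Omega)}^2\qquad\text{for all }(a_\gamma)\in\ell^2(\Gamma), \] where $C(d)=(1-\sqrt{1-d})^2$.
   Context: $|\Omega|$ denotes the normalized Lebesgue measure on $[0,2\pi]$, i.e. $|\Omega|=\frac{1}{2\pi}\mathrm{Leb}(\Omega)$, and the norm of $L^2(\Omega)$ is taken with respect to this normalized measure. For $\Gamma\subset\mathbb{Z}$, $D^-(\Gamma)=\lim_{r\to\infty}\frac{\min_{x\in\mathbb{R}}|\Gamma\cap[x,x+r]|}{r}$ and $D^+(\Gamma)=\lim_{r\to\infty}\frac{\max_{x\in\mathbb{R}}|\Gamma\cap[x,x+r]|}{r}$ ($|\cdot|$ of a finite set is its cardinality); $\Gamma$ has uniform density $D(\Gamma)$ if $D^-(\Gamma)=D^+(\Gamma)=:D(\Gamma)$. *)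

theory Defs
  imports "HOL-Analysis.Analysis"
begin

definition nmeasure :: "real set \<Rightarrow> real" where
  "nmeasure \<Omega> = measure lborel \<Omega> / (2 * pi)"

definition count_in :: "int set \<Rightarrow> real \<Rightarrow> real \<Rightarrow> real" where
  "count_in \<Gamma> x r = real (card {\<gamma>\<in>\<Gamma>. x \<le> real_of_int \<gamma> \<and> real_of_int \<gamma> \<le> x + r})"

definition has_uniform_density :: "int set \<Rightarrow> real \<Rightarrow> bool" where
  "has_uniform_density \<Gamma> D \<longleftrightarrow>
     ((\<lambda>r. (INF x. count_in \<Gamma> x r) / r) \<longlongrightarrow> D) at_top \<and>
     ((\<lambda>r. (SUP x. count_in \<Gamma> x r) / r) \<longlongrightarrow> D) at_top"

definition partial_exp_sum :: "int set \<Rightarrow> (int \<Rightarrow> complex) \<Rightarrow> nat \<Rightarrow> real \<Rightarrow> complex" where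
  "partial_exp_sum \<Gamma> a N t =
     (\<Sum>\<gamma>\<in>{\<gamma>\<in>\<Gamma>. \<bar>\<gamma>\<bar> \<le> int N}. a \<gamma> * exp (\<i> * of_int \<gamma> * of_real t))"

definition is_L2_sum :: "int set \<Rightarrow> (int \<Rightarrow> complex) \<Rightarrow> (real \<Rightarrow> complex) \<Rightarrow> bool" where
  "is_L2_sum \<Gamma> a f \<longleftrightarrow>
     f \<in> borel_measurable lborel \<and>
     set_integrable lborel {0..2*pi} (\<lambda>t. (cmod (f t))\<^sup>2) \<and>
     ((\<lambda>N. LINT t:{0..2*pi}|lborel. (cmod (f t - partial_exp_sum \<Gamma> a N t))\<^sup>2) \<longlonglongrightarrow> 0)"

definition L2_norm_sq_on :: "real set \<Rightarrow> (real \<Rightarrow> complex) \<Rightarrow> real" where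
  "L2_norm_sq_on \<Omega> f = (LINT t:\<Omega>|lborel. (cmod (f t))\<^sup>2) / (2 * pi)"

end

theory Submission
  imports Defs "Jordan_Normal_Form.Schur_Decomposition"
begin

text \<open>
  Approximate \<open>\<Omega>\<close> from inside by cells of a grid with \<open>N\<close> cells, indexed by \<open>J\<close>, and look for
  \<open>\<Gamma>\<close> periodic with period \<open>N\<close>, given by a set \<open>S\<close> of residues. Evaluating a trigonometric
  polynomial with frequencies in \<open>\<Gamma>\<close> along \<open>t + 2 * pi * j / N\<close> reduces the estimate to a lower bound
  for the principal submatrix on \<open>S\<close> of the projection \<open>P = F\<^sub>J\<^sup>* F\<^sub>J\<close>, where \<open>F\<^sub>J\<close> consists of the
  rows \<open>J\<close> of the unitary Fourier matrix.

  The set \<open>S\<close> is found by deleting indices one at a time. For eigenvalues \<open>\<lambda>\<close> of the current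
  submatrix above a barrier \<open>b\<close>, let \<open>\<Phi>\<close> be the sum of \<open>1 / (\<lambda> - b)\<close>. The derivative of a
  characteristic polynomial is the sum of the characteristic polynomials of the one-index deletions,
  so some deletion does no worse than the average, and this allows the barrier to move up by
  \<open>1 / \<Phi>\<close> without increasing \<open>\<Phi>\<close>. Starting at \<open>b = - (1 - q) / q\<close> with \<open>q = sqrt (1 - d)\<close>, the
  barrier finally exceeds \<open>(1 - q)\<^sup>2 |\<Omega>|\<close> with room to spare. The slack pays for the
  approximation of \<open>\<Omega>\<close> and the strict density inequality.
\<close>

subsection \<open>Hermitian forms and the least eigenvalue\<close>

text \<open>Vectors and matrices are plain functions of which only the indices below
  \<open>n\<close> count. A principal submatrix is then a composition with an index map, and
  \<open>mat_upto\<close> passes to the matrix type only for determinants, eigenvalues and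
  characteristic polynomials.\<close>

definition mat_app :: "(nat \<Rightarrow> nat \<Rightarrow> complex) \<Rightarrow> nat \<Rightarrow> (nat \<Rightarrow> complex) \<Rightarrow> nat \<Rightarrow> complex" where
  "mat_app A n x i = (\<Sum>j<n. A i j * x j)"

definition inner_upto :: "nat \<Rightarrow> (nat \<Rightarrow> complex) \<Rightarrow> (nat \<Rightarrow> complex) \<Rightarrow> complex" where
  "inner_upto n x y = (\<Sum>i<n. x i * cnj (y i))"

definition norm_sq_upto :: "nat \<Rightarrow> (nat \<Rightarrow> complex) \<Rightarrow> real" where
  "norm_sq_upto n x = (\<Sum>i<n. (cmod (x i))\<^sup>2)"

abbreviation mat_upto :: "nat \<Rightarrow> (nat \<Rightarrow> nat \<Rightarrow> complex) \<Rightarrow> complex mat" where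
  "mat_upto n A \<equiv> Matrix.mat n n (\<lambda>(i, j). A i j)"

lemma norm_sq_upto_nonneg: "0 \<le> norm_sq_upto n x"
  by (simp add: norm_sq_upto_def sum_nonneg)

lemma norm_sq_upto_eq_0_iff: "norm_sq_upto n x = 0 \<longleftrightarrow> (\<forall>i<n. x i = 0)"
  by (auto simp: norm_sq_upto_def sum_nonneg_eq_0_iff)

lemma inner_upto_self: "inner_upto n x x = of_real (norm_sq_upto n x)"
  by (simp add: inner_upto_def norm_sq_upto_def complex_norm_square[symmetric])

lemma inner_upto_le: "2 * \<bar>Re (inner_upto n x y)\<bar> \<le> norm_sq_upto n x + norm_sq_upto n y"
proof -
  have *: "2 * \<bar>Re (x i * cnj (y i))\<bar> \<le> (cmod (x i))\<^sup>2 + (cmod (y i))\<^sup>2" for i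
  proof -
    have "\<bar>Re (x i * cnj (y i))\<bar> \<le> cmod (x i) * cmod (y i)"
      using abs_Re_le_cmod[of "x i * cnj (y i)"] by (simp add: norm_mult)
    moreover have "2 * (cmod (x i) * cmod (y i)) \<le> (cmod (x i))\<^sup>2 + (cmod (y i))\<^sup>2"
      using sum_squares_bound[of "cmod (x i)" "cmod (y i)"] by simp
    ultimately show ?thesis by linarith
  qed
  have "2 * \<bar>Re (inner_upto n x y)\<bar> \<le> (\<Sum>i<n. 2 * \<bar>Re (x i * cnj (y i))\<bar>)"
    unfolding inner_upto_def Re_sum sum_distrib_left[symmetric]
    by (intro mult_left_mono sum_abs) auto
  also have "\<dots> \<le> (\<Sum>i<n. (cmod (x i))\<^sup>2 + (cmod (y i))\<^sup>2)"
    by (intro sum_mono *)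
  finally show ?thesis by (simp add: norm_sq_upto_def sum.distrib)
qed

text \<open>Cauchy-Schwarz in each row gives the squared Frobenius norm \<open>K\<close> as a bound.
  Adding 1 keeps the constant positive for the zero matrix.\<close>

lemma mat_app_bounded: "\<exists>K>0. \<forall>x. norm_sq_upto n (mat_app A n x) \<le> K * norm_sq_upto n x"
proof -
  define K where "K = (\<Sum>i<n. \<Sum>j<n. (cmod (A i j))\<^sup>2)"
  have "norm_sq_upto n (mat_app A n x) \<le> K * norm_sq_upto n x" for x
  proof -
    have "(cmod (mat_app A n x i))\<^sup>2 \<le> (\<Sum>j<n. (cmod (A i j))\<^sup>2) * norm_sq_upto n x" for i
    proof -
      have "cmod (mat_app A n x i) \<le> (\<Sum>j<n. cmod (A i j) * cmod (x j))"
        unfolding mat_app_def by (rule order_trans[OF norm_sum]) (simp add: norm_mult)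
      hence "(cmod (mat_app A n x i))\<^sup>2 \<le> (\<Sum>j<n. cmod (A i j) * cmod (x j))\<^sup>2"
        by (simp add: power_mono)
      also have "\<dots> \<le> (\<Sum>j<n. (cmod (A i j))\<^sup>2) * norm_sq_upto n x"
        unfolding norm_sq_upto_def by (rule Cauchy_Schwarz_ineq_sum)
      finally show ?thesis .
    qed
    thus ?thesis
      by (auto simp: norm_sq_upto_def[of n "mat_app A n x"] K_def sum_distrib_right intro!: sum_mono)
  qed
  moreover have "K \<ge> 0" by (simp add: K_def sum_nonneg)
  ultimately have "norm_sq_upto n (mat_app A n x) \<le> (K + 1) * norm_sq_upto n x" for x
    using norm_sq_upto_nonneg[of n x] by (simp add: distrib_right add_increasing2)
  with \<open>K \<ge> 0\<close> show ?thesis by (intro exI[of _ "K + 1"]) auto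
qed

lemma inner_mat_app_bounded:
  "\<exists>K>0. \<forall>x. \<bar>Re (inner_upto n (mat_app A n x) x)\<bar> \<le> K * norm_sq_upto n x"
proof -
  obtain K where K: "K > 0" "\<And>x. norm_sq_upto n (mat_app A n x) \<le> K * norm_sq_upto n x"
    using mat_app_bounded by blast
  have "\<bar>Re (inner_upto n (mat_app A n x) x)\<bar> \<le> (K + 1) / 2 * norm_sq_upto n x" for x
    using inner_upto_le[of n "mat_app A n x" x] K(2)[of x] by (simp add: field_simps)
  with K(1) show ?thesis by (intro exI[of _ "(K + 1) / 2"]) auto
qed

lemma inner_mat_app_hermitian:
  assumes "\<And>i j. A j i = cnj (A i j)"
  shows "inner_upto n (mat_app A n x) y = inner_upto n x (mat_app A n y)"
proof -
  have "inner_upto n (mat_app A n x) y = (\<Sum>i<n. \<Sum>j<n. A i j * x j * cnj (y i))"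
    by (simp add: inner_upto_def mat_app_def sum_distrib_right)
  also have "\<dots> = (\<Sum>j<n. \<Sum>i<n. A i j * x j * cnj (y i))"
    by (rule sum.swap)
  also have "\<dots> = (\<Sum>j<n. \<Sum>i<n. x j * cnj (A j i * y i))"
    using assms by (intro sum.cong refl) (metis complex_cnj_mult mult.assoc mult.commute)
  finally show ?thesis
    by (simp add: inner_upto_def mat_app_def sum_distrib_left)
qed

text \<open>The form is tested at the gradient step \<open>z = x - y / K\<close>, where
  \<open>y\<close> is the image of \<open>x\<close> and \<open>K\<close> bounds the form. Expanding,
  the cross terms give -2 |y|^2 / K and the quadratic term at most |y|^2 / K, so nonnegativity at
  \<open>z\<close> is the claim.\<close>

lemma psd_norm_sq_mat_app_le:
  assumes herm: "\<And>i j. A j i = cnj (A i j)"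
    and psd: "\<And>x. 0 \<le> Re (inner_upto n (mat_app A n x) x)"
  shows "\<exists>K>0. \<forall>x. norm_sq_upto n (mat_app A n x) \<le> K * Re (inner_upto n (mat_app A n x) x)"
proof -
  obtain K where K: "K > 0" "\<And>x. \<bar>Re (inner_upto n (mat_app A n x) x)\<bar> \<le> K * norm_sq_upto n x"
    using inner_mat_app_bounded by blast
  have "norm_sq_upto n (mat_app A n x) \<le> K * Re (inner_upto n (mat_app A n x) x)" for x
  proof -
    define y where "y = mat_app A n x"
    define t :: complex where "t = of_real (1 / K)"
    define z where "z i = x i - t * y i" for i
    have Az: "mat_app A n z i = y i - t * mat_app A n y i" for i
      by (simp add: mat_app_def z_def y_def algebra_simps sum_subtractf sum_distrib_left)
    have t: "cnj t = t" by (simp add: t_def)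
    have "inner_upto n (mat_app A n z) z = inner_upto n y x - t * inner_upto n y y
        - t * inner_upto n (mat_app A n y) x + t\<^sup>2 * inner_upto n (mat_app A n y) y"
      unfolding inner_upto_def Az z_def
      by (simp add: t algebra_simps sum_subtractf sum_distrib_left sum.distrib power2_eq_square)
    also have "inner_upto n (mat_app A n y) x = of_real (norm_sq_upto n y)"
      using inner_mat_app_hermitian[of A n y x, OF herm] by (simp add: y_def inner_upto_self)
    finally have "Re (inner_upto n (mat_app A n z) z) = Re (inner_upto n y x)
        - 2 / K * norm_sq_upto n y + (1 / K)\<^sup>2 * Re (inner_upto n (mat_app A n y) y)"
      by (simp add: t_def inner_upto_self flip: of_real_power of_real_mult of_real_divide)
    moreover have "(1 / K)\<^sup>2 * Re (inner_upto n (mat_app A n y) y) \<le> (1 / K)\<^sup>2 * (K * norm_sq_upto n y)"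
      using K(2)[of y] by (intro mult_left_mono) auto
    moreover have "(1 / K)\<^sup>2 * (K * norm_sq_upto n y) = norm_sq_upto n y / K"
      using K(1) by (simp add: field_simps power2_eq_square)
    moreover have "2 / K * norm_sq_upto n y = 2 * (norm_sq_upto n y / K)"
      by simp
    ultimately have "0 \<le> Re (inner_upto n y x) - norm_sq_upto n y / K"
      using psd[of z] by linarith
    thus ?thesis using K(1) by (simp add: y_def field_simps)
  qed
  with K(1) show ?thesis by blast
qed

lemma eigenvalue_mat_upto_iff:
  "eigenvalue (mat_upto n A) c \<longleftrightarrow> (\<exists>x. (\<exists>i<n. x i \<noteq> 0) \<and> (\<forall>i<n. mat_app A n x i = c * x i))"
proof
  assume "eigenvalue (mat_upto n A) c"
  then obtain v where v: "v \<in> carrier_vec n" "v \<noteq> 0\<^sub>v n" "mat_upto n A *\<^sub>v v = c \<cdot>\<^sub>v v"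
    by (auto simp: eigenvalue_def eigenvector_def)
  have "mat_app A n (vec_index v) i = c * vec_index v i" if "i < n" for i
    using arg_cong[OF v(3), of "\<lambda>w. vec_index w i"] that v(1)
    by (simp add: mat_app_def scalar_prod_def lessThan_atLeast0)
  moreover have "\<exists>i<n. vec_index v i \<noteq> 0"
    using v(1,2) by (metis carrier_vecD eq_vecI index_zero_vec)
  ultimately show "\<exists>x. (\<exists>i<n. x i \<noteq> 0) \<and> (\<forall>i<n. mat_app A n x i = c * x i)" by blast
next
  assume "\<exists>x. (\<exists>i<n. x i \<noteq> 0) \<and> (\<forall>i<n. mat_app A n x i = c * x i)"
  then obtain x where x: "\<exists>i<n. x i \<noteq> 0" "\<And>i. i < n \<Longrightarrow> mat_app A n x i = c * x i" by blast
  have "mat_upto n A *\<^sub>v Matrix.vec n x = c \<cdot>\<^sub>v Matrix.vec n x"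
    by (rule eq_vecI) (use x(2) in \<open>auto simp: mat_app_def scalar_prod_def lessThan_atLeast0\<close>)
  moreover have "Matrix.vec n x \<noteq> 0\<^sub>v n"
    using x(1) by (metis index_vec index_zero_vec(1))
  ultimately show "eigenvalue (mat_upto n A) c"
    by (auto simp: eigenvalue_def eigenvector_def intro!: exI[of _ "Matrix.vec n x"])
qed


text \<open>
  The supremum of the lower bounds of the quadratic form is an eigenvalue: otherwise the shifted
  matrix is positive semidefinite and invertible, hence bounded below, and the bound could be raised.
\<close>

lemma hermitian_least_eigenvalue:
  assumes herm: "\<And>i j. A j i = cnj (A i j)" and "n > 0"
  shows "\<exists>c::real. eigenvalue (mat_upto n A) (of_real c) \<and>
    (\<forall>x. c * norm_sq_upto n x \<le> Re (inner_upto n (mat_app A n x) x))"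
proof -
  define q where "q x = Re (inner_upto n (mat_app A n x) x)" for x
  define C where "C = {c. \<forall>x. c * norm_sq_upto n x \<le> q x}"
  obtain K where K: "K > 0" "\<And>x. \<bar>q x\<bar> \<le> K * norm_sq_upto n x"
    using inner_mat_app_bounded unfolding q_def by blast
  have "- K \<in> C"
    unfolding C_def
  proof safe
    fix x
    show "- K * norm_sq_upto n x \<le> q x" using K(2)[of x] by simp
  qed
  have ub: "c \<le> K" if "c \<in> C" for c
  proof -
    \<comment> \<open>The first unit vector, available since \<open>n > 0\<close>, has form value at
      most \<open>K\<close> and so bounds \<open>C\<close> above.\<close>
    define x :: "nat \<Rightarrow> complex" where "x i = (if i = 0 then 1 else 0)" for i
    have "norm_sq_upto n x = (\<Sum>i<n. if i = 0 then 1 else 0)"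
      unfolding norm_sq_upto_def by (intro sum.cong) (auto simp: x_def)
    hence "norm_sq_upto n x = 1" using \<open>n > 0\<close> by simp
    moreover have "c * norm_sq_upto n x \<le> q x" using that by (auto simp: C_def)
    ultimately show ?thesis using K(2)[of x] by simp
  qed
  hence bdd: "bdd_above C" unfolding bdd_above_def by blast
  define c where "c = Sup C"
  have cC: "c \<in> C"
    unfolding C_def
  proof safe
    fix x
    show "c * norm_sq_upto n x \<le> q x"
    proof (cases "norm_sq_upto n x = 0")
      case True
      thus ?thesis using K(2)[of x] by simp
    next
      case False
      hence pos: "norm_sq_upto n x > 0" using norm_sq_upto_nonneg[of n x] by linarith
      have "c \<le> q x / norm_sq_upto n x"
        unfolding c_def
      proof (rule cSup_least)
        show "C \<noteq> {}" using \<open>- K \<in> C\<close> by blast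
        show "u \<le> q x / norm_sq_upto n x" if "u \<in> C" for u
          using that pos by (simp add: C_def pos_le_divide_eq)
      qed
      thus ?thesis using pos by (simp add: field_simps)
    qed
  qed
  have "eigenvalue (mat_upto n A) (of_real c)"
  proof (rule ccontr)
    assume not_ev: "\<not> eigenvalue (mat_upto n A) (of_real c)"
    define M where "M i j = A i j - (if i = j then of_real c else 0)" for i j
    have Mapp: "mat_app M n x i = mat_app A n x i - of_real c * x i" if "i < n" for x i
      using that by (simp add: mat_app_def M_def algebra_simps sum_subtractf if_distrib[of "\<lambda>u. u * _"]
          if_distrib[of "\<lambda>u. _ * u"] cong: if_cong)
    have Mq: "Re (inner_upto n (mat_app M n x) x) = q x - c * norm_sq_upto n x" for x
    proof -
      have "inner_upto n (mat_app M n x) x = inner_upto n (mat_app A n x) x - of_real c * inner_upto n x x"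
        by (simp add: inner_upto_def Mapp algebra_simps sum_subtractf sum_distrib_left)
      thus ?thesis by (simp add: q_def inner_upto_self)
    qed
    have hermM: "M j i = cnj (M i j)" for i j
      unfolding M_def by (subst herm) simp
    have "0 \<le> Re (inner_upto n (mat_app M n x) x)" for x
      using cC by (simp add: Mq C_def)
    from psd_norm_sq_mat_app_le[of M n, OF hermM this]
    obtain K1 where K1: "K1 > 0" "\<And>x. norm_sq_upto n (mat_app M n x) \<le> K1 * (q x - c * norm_sq_upto n x)"
      unfolding Mq by blast
    have "Determinant.det (mat_upto n M) \<noteq> 0"
    proof
      assume "Determinant.det (mat_upto n M) = 0"
      then obtain v where v: "v \<in> carrier_vec n" "v \<noteq> 0\<^sub>v n" "mat_upto n M *\<^sub>v v = 0\<^sub>v n"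
        using det_0_iff_vec_prod_zero[of "mat_upto n M" n] by auto
      hence "eigenvalue (mat_upto n M) 0"
        by (auto simp: eigenvalue_def eigenvector_def intro!: exI[of _ v])
      hence "eigenvalue (mat_upto n A) (of_real c)"
        by (auto simp: eigenvalue_mat_upto_iff Mapp)
      with not_ev show False by blast
    qed
    then obtain B where B: "B \<in> carrier_mat n n" "B * mat_upto n M = 1\<^sub>m n"
      using det_non_zero_imp_unit[of "mat_upto n M" n] 
      by (auto simp: Units_def ring_mat_def)
    define B' where "B' i j = B $$ (i, j)" for i j
    have inv: "mat_app B' n (mat_app M n x) i = x i" if "i < n" for x i
    proof -
      have "mat_app B' n (mat_app M n x) i = (\<Sum>j<n. \<Sum>k<n. B' i j * M j k * x k)"
        by (simp add: mat_app_def sum_distrib_left mult.assoc)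
      also have "\<dots> = (\<Sum>k<n. (\<Sum>j<n. B' i j * M j k) * x k)"
        by (subst sum.swap) (simp add: sum_distrib_right)
      also have "\<dots> = (\<Sum>k<n. (B * mat_upto n M) $$ (i, k) * x k)"
        using B(1) that by (intro sum.cong refl)
          (auto simp: B'_def scalar_prod_def lessThan_atLeast0)
      also have "\<dots> = (\<Sum>k<n. (if i = k then x k else 0))"
        unfolding B(2) using that by (intro sum.cong refl) auto
      also have "\<dots> = x i" using that by simp
      finally show ?thesis .
    qed
    obtain K2 where K2: "K2 > 0" "\<And>y. norm_sq_upto n (mat_app B' n y) \<le> K2 * norm_sq_upto n y"
      using mat_app_bounded by blast
    have "norm_sq_upto n x \<le> K2 * K1 * (q x - c * norm_sq_upto n x)" for x
    proof -
      have "norm_sq_upto n x = norm_sq_upto n (mat_app B' n (mat_app M n x))"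
        by (simp add: norm_sq_upto_def inv)
      also have "\<dots> \<le> K2 * norm_sq_upto n (mat_app M n x)" by (rule K2(2))
      also have "\<dots> \<le> K2 * (K1 * (q x - c * norm_sq_upto n x))"
        using K1(2)[of x] K2(1) by (intro mult_left_mono) auto
      finally show ?thesis by (simp add: mult.assoc)
    qed
    hence "c + 1 / (K2 * K1) \<in> C"
      using K1(1) K2(1) by (auto simp: C_def field_simps)
    hence "c + 1 / (K2 * K1) \<le> c" unfolding c_def using bdd by (intro cSup_upper)
    thus False using K1(1) K2(1) by (simp add: field_simps)
  qed
  with cC show ?thesis unfolding C_def q_def by blast
qed

subsection \<open>Deleting indices with a barrier\<close>

text \<open>Enumerates the eigenvalues with algebraic multiplicity and in no particular order. That
  they are real is part of the notion, so potentials and barriers can be real numbers.\<close>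

definition has_spectrum :: "(nat \<Rightarrow> nat \<Rightarrow> complex) \<Rightarrow> nat \<Rightarrow> (nat \<Rightarrow> real) \<Rightarrow> bool" where
  "has_spectrum A n l \<longleftrightarrow> char_poly (mat_upto n A) = (\<Prod>i<n. [:- complex_of_real (l i), 1:])"

lemma has_spectrum_eigenvalue_iff:
  assumes "has_spectrum A n l"
  shows "eigenvalue (mat_upto n A) c \<longleftrightarrow> (\<exists>i<n. c = of_real (l i))"
  using assms by (auto simp: has_spectrum_def eigenvalue_root_char_poly[of _ n] poly_prod)

lemma hermitian_eigenvalue_real:
  assumes herm: "\<And>i j. A j i = cnj (A i j)" and ev: "eigenvalue (mat_upto n A) c"
  shows "c = of_real (Re c)"
proof -
  obtain x where x: "\<exists>i<n. x i \<noteq> 0" "\<And>i. i < n \<Longrightarrow> mat_app A n x i = c * x i"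
    using ev by (auto simp: eigenvalue_mat_upto_iff)
  have "inner_upto n (mat_app A n x) x = c * of_real (norm_sq_upto n x)"
    unfolding inner_upto_self[symmetric] by (simp add: inner_upto_def x(2) sum_distrib_left mult.assoc)
  moreover have "inner_upto n x (mat_app A n x) = cnj c * of_real (norm_sq_upto n x)"
    unfolding inner_upto_self[symmetric]
    by (simp add: inner_upto_def x(2) sum_distrib_left mult_ac)
  ultimately have "c * of_real (norm_sq_upto n x) = cnj c * of_real (norm_sq_upto n x)"
    using inner_mat_app_hermitian[of A n x x, OF herm] by metis
  moreover have "norm_sq_upto n x \<noteq> 0" using x(1) by (auto simp: norm_sq_upto_eq_0_iff)
  ultimately show ?thesis by (simp add: complex_eq_iff)
qed

lemma hermitian_has_spectrum:
  assumes herm: "\<And>i j. A j i = cnj (A i j)"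
  shows "\<exists>l. has_spectrum A n l"
proof -
  obtain as where as: "char_poly (mat_upto n A) = (\<Prod>a\<leftarrow>as. [:- a, 1:])" "length as = n"
    using char_poly_factorized[of "mat_upto n A" n] by auto
  have "of_real (Re (as ! i)) = as ! i" if "i < n" for i
  proof -
    have "poly (char_poly (mat_upto n A)) (as ! i) = 0"
      using that as(2) by (auto simp: as(1) poly_prod_list prod_list_zero_iff intro!: image_eqI[of _ _ "as ! i"])
    hence "eigenvalue (mat_upto n A) (as ! i)"
      by (simp add: eigenvalue_root_char_poly[of _ n])
    from hermitian_eigenvalue_real[of A, OF herm this] show ?thesis by simp
  qed
  hence "has_spectrum A n (\<lambda>i. Re (as ! i))"
    using as(2) by (simp add: has_spectrum_def as(1) prod.list_conv_set_nth lessThan_atLeast0)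
  thus ?thesis by blast
qed

lemma spectrum_eigenvector:
  assumes "has_spectrum A n l" and "i < n"
  obtains x where "norm_sq_upto n x > 0"
    "Re (inner_upto n (mat_app A n x) x) = l i * norm_sq_upto n x"
proof -
  have "eigenvalue (mat_upto n A) (of_real (l i))"
    using assms by (auto simp: has_spectrum_eigenvalue_iff)
  then obtain x where x: "\<exists>i<n. x i \<noteq> 0" "\<And>j. j < n \<Longrightarrow> mat_app A n x j = of_real (l i) * x j"
    by (auto simp: eigenvalue_mat_upto_iff)
  have "inner_upto n (mat_app A n x) x = of_real (l i) * of_real (norm_sq_upto n x)"
    unfolding inner_upto_self[symmetric] by (simp add: inner_upto_def x(2) sum_distrib_left mult.assoc)
  moreover have "norm_sq_upto n x > 0"
    using x(1) norm_sq_upto_nonneg[of n x] norm_sq_upto_eq_0_iff[of n x] by force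
  ultimately show ?thesis using that by simp
qed

lemma spectrum_lower_bound:
  assumes "has_spectrum A n l" and "i < n"
    and "\<And>x. c * norm_sq_upto n x \<le> Re (inner_upto n (mat_app A n x) x)"
  shows "c \<le> l i"
  using spectrum_eigenvector[OF assms(1,2)] assms(3) by (metis mult_le_cancel_right_pos)

lemma spectrum_upper_bound:
  assumes "has_spectrum A n l" and "i < n"
    and "\<And>x. Re (inner_upto n (mat_app A n x) x) \<le> c * norm_sq_upto n x"
  shows "l i \<le> c"
  using spectrum_eigenvector[OF assms(1,2)] assms(3) by (metis mult_le_cancel_right_pos)

text \<open>Leads back from eigenvalues to a bound for the form without diagonalising: the least
  eigenvalue found variationally must be one of the \<open>l i\<close>.\<close>

lemma spectrum_least_form:
  assumes "\<And>i j. A j i = cnj (A i j)" and "n > 0" and "has_spectrum A n l"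
  obtains i where "i < n" "\<And>x. l i * norm_sq_upto n x \<le> Re (inner_upto n (mat_app A n x) x)"
proof -
  obtain c where c: "eigenvalue (mat_upto n A) (complex_of_real c)"
      "\<And>x. c * norm_sq_upto n x \<le> Re (inner_upto n (mat_app A n x) x)"
    using hermitian_least_eigenvalue[of A n, OF assms(1,2)] by blast
  from c(1) obtain i where "i < n" "c = l i"
    using assms(3) by (auto simp: has_spectrum_eigenvalue_iff)
  with c(2) that show ?thesis by blast
qed

text \<open>A vector on the selected indices extends by zero to a vector \<open>y\<close> on all of
  them with the same norm and the same form value. This yields the half of Cauchy interlacing that
  controls least eigenvalues.\<close>

lemma form_compress:
  assumes inj: "inj_on e {..<k}" and sub: "e ` {..<k} \<subseteq> {..<n}"
    and form: "\<And>x. c * norm_sq_upto n x \<le> Re (inner_upto n (mat_app A n x) x)"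
  shows "c * norm_sq_upto k x \<le> Re (inner_upto k (mat_app (\<lambda>i j. A (e i) (e j)) k x) x)"
proof -
  define y where "y i = (if i \<in> e ` {..<k} then x (inv_into {..<k} e i) else 0)" for i
  have y: "y (e i) = x i" if "i < k" for i
    using that inj by (simp add: y_def)
  have y0: "y i = 0" if "i \<notin> e ` {..<k}" for i
    using that by (simp add: y_def)
  have reindex: "(\<Sum>i<n. f i) = (\<Sum>i<k. f (e i))" if "\<And>i. i \<notin> e ` {..<k} \<Longrightarrow> f i = 0"
    for f :: "nat \<Rightarrow> 'z::comm_monoid_add"
  proof -
    have "(\<Sum>i<n. f i) = (\<Sum>i\<in>e ` {..<k}. f i)"
      using sub that by (intro sum.mono_neutral_right) auto
    also have "\<dots> = (\<Sum>i<k. f (e i))"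
      using inj by (simp add: sum.reindex)
    finally show ?thesis .
  qed
  have "norm_sq_upto n y = norm_sq_upto k x"
    unfolding norm_sq_upto_def by (subst reindex) (auto simp: y y0)
  moreover have "mat_app A n y (e i) = mat_app (\<lambda>i j. A (e i) (e j)) k x i" for i
    unfolding mat_app_def by (subst reindex) (auto simp: y y0)
  hence "inner_upto n (mat_app A n y) y = inner_upto k (mat_app (\<lambda>i j. A (e i) (e j)) k x) x"
    unfolding inner_upto_def by (subst reindex) (auto simp: y y0)
  ultimately show ?thesis using form[of y] by simp
qed

text \<open>The first identity is the logarithmic derivative p'/p. The second is p''/p = (p'/p)^2 +
  (p'/p)'. They are proved jointly, because the induction step for p'' uses the formula for
  p'.\<close>

lemma poly_pderiv_prod_linear:
  fixes c :: "nat \<Rightarrow> 'a::field_char_0"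
  assumes "\<And>i. i < n \<Longrightarrow> z \<noteq> c i"
  defines "p \<equiv> (\<Prod>i<n. [:- c i, 1:])"
  shows "poly (pderiv p) z = poly p z * (\<Sum>i<n. 1 / (z - c i))"
    and "poly (pderiv (pderiv p)) z = poly p z * ((\<Sum>i<n. 1 / (z - c i))\<^sup>2 - (\<Sum>i<n. 1 / (z - c i)\<^sup>2))"
proof -
  have "poly (pderiv p) z = poly p z * (\<Sum>i<n. 1 / (z - c i)) \<and>
    poly (pderiv (pderiv p)) z = poly p z * ((\<Sum>i<n. 1 / (z - c i))\<^sup>2 - (\<Sum>i<n. 1 / (z - c i)\<^sup>2))"
    using assms(1) unfolding p_def
  proof (induction n)
    case 0
    show ?case by (simp add: one_pCons pderiv_pCons)
  next
    case (Suc n)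
    let ?p = "\<Prod>i<n. [:- c i, 1:]"
    have nz: "z - c n \<noteq> 0" using Suc.prems by auto
    have IH: "poly (pderiv ?p) z = poly ?p z * (\<Sum>i<n. 1 / (z - c i))"
      "poly (pderiv (pderiv ?p)) z = poly ?p z * ((\<Sum>i<n. 1 / (z - c i))\<^sup>2 - (\<Sum>i<n. 1 / (z - c i)\<^sup>2))"
      using Suc by auto
    have 1: "pderiv (?p * [:- c n, 1:]) = ?p + pderiv ?p * [:- c n, 1:]"
      unfolding pderiv_mult by (simp add: pderiv_pCons)
    have 2: "pderiv (pderiv (?p * [:- c n, 1:])) = 2 * pderiv ?p + pderiv (pderiv ?p) * [:- c n, 1:]"
      unfolding 1 pderiv_add pderiv_mult by (simp add: pderiv_pCons)
    define P S T where "P = poly ?p z" and "S = (\<Sum>i<n. 1 / (z - c i))" and "T = (\<Sum>i<n. 1 / (z - c i)\<^sup>2)"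
    define g where "g = z - c n"
    have g: "poly [:- c n, 1:] z = g" "g \<noteq> 0" using nz by (auto simp: g_def)
    have "poly (pderiv (?p * [:- c n, 1:])) z = P + P * S * g"
      unfolding 1 poly_add poly_mult IH g P_def S_def ..
    also have "\<dots> = P * g * (S + 1 / g)" using g(2) by (simp add: field_simps)
    finally have p1: "poly (pderiv (?p * [:- c n, 1:])) z = P * g * (S + 1 / g)" .
    have "poly (pderiv (pderiv (?p * [:- c n, 1:]))) z = 2 * (P * S) + P * (S\<^sup>2 - T) * g"
      unfolding 2 poly_add poly_mult IH g P_def S_def T_def by simp
    also have "\<dots> = P * g * ((S + 1 / g)\<^sup>2 - (T + 1 / g\<^sup>2))"
      using g(2) by (simp add: field_simps power2_eq_square)
    finally have p2: "poly (pderiv (pderiv (?p * [:- c n, 1:]))) z =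
        P * g * ((S + 1 / g)\<^sup>2 - (T + 1 / g\<^sup>2))" .
    have p0: "poly (?p * [:- c n, 1:]) z = P * g"
      unfolding poly_mult g P_def ..
    show ?case
      unfolding prod.lessThan_Suc sum.lessThan_Suc p0 p1 p2 unfolding S_def T_def g_def by simp
  qed
  thus "poly (pderiv p) z = poly p z * (\<Sum>i<n. 1 / (z - c i))"
    and "poly (pderiv (pderiv p)) z = poly p z * ((\<Sum>i<n. 1 / (z - c i))\<^sup>2 - (\<Sum>i<n. 1 / (z - c i)\<^sup>2))"
    by blast+
qed

text \<open>Translates the derivatives of the characteristic polynomial at a barrier into real
  potentials. The potentials use the positive gaps \<open>l i - b\<close>, opposite to the
  polynomial's factors, whence the sign in \<open>- Q * F\<close>.\<close>

lemma has_spectrum_poly: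
  assumes spec: "has_spectrum A n l" and l: "\<And>i. i < n \<Longrightarrow> b < l i"
  defines "p \<equiv> char_poly (mat_upto n A)" and "Q \<equiv> \<Prod>i<n. b - l i"
    and "F \<equiv> \<Sum>i<n. 1 / (l i - b)"
  shows "poly p (of_real b) = of_real Q"
    and "poly (pderiv p) (of_real b) = of_real (- Q * F)"
    and "poly (pderiv (pderiv p)) (of_real b) = of_real (Q * (F\<^sup>2 - (\<Sum>i<n. 1 / (l i - b)\<^sup>2)))"
proof -
  have p: "p = (\<Prod>i<n. [:- complex_of_real (l i), 1:])"
    using spec by (simp add: p_def has_spectrum_def)
  show pQ: "poly p (of_real b) = of_real Q"
    by (simp add: p Q_def poly_prod)
  have ne: "complex_of_real b \<noteq> of_real (l i)" if "i < n" for i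
    using l[OF that] by simp
  have "1 / (complex_of_real b - complex_of_real t) = of_real (- (1 / (t - b)))" for t
    by (metis minus_diff_eq minus_divide_right of_real_1 of_real_diff of_real_divide)
  hence F: "(\<Sum>i<n. 1 / (complex_of_real b - complex_of_real (l i))) = of_real (- F)"
    by (simp add: F_def sum_negf)
  have "1 / (complex_of_real b - complex_of_real t)\<^sup>2 = of_real (1 / (t - b)\<^sup>2)" for t
    by (simp add: power2_commute)
  hence F2: "(\<Sum>i<n. 1 / (complex_of_real b - complex_of_real (l i))\<^sup>2) = of_real (\<Sum>i<n. 1 / (l i - b)\<^sup>2)"
    by simp
  show "poly (pderiv p) (of_real b) = of_real (- Q * F)"
    using poly_pderiv_prod_linear(1)[of n "of_real b" "\<lambda>i. of_real (l i)", OF ne]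
    unfolding F p[symmetric] pQ by simp
  show "poly (pderiv (pderiv p)) (of_real b) = of_real (Q * (F\<^sup>2 - (\<Sum>i<n. 1 / (l i - b)\<^sup>2)))"
    using poly_pderiv_prod_linear(2)[of n "of_real b" "\<lambda>i. of_real (l i)", OF ne]
    unfolding F F2 p[symmetric] pQ by simp
qed

text \<open>The last inequality amounts to \<open>F\<^sup>2 - F2 \<le> F * \<Phi>\<close>, with
  \<open>F2\<close> its right-hand side. Since (F^2 - F2) / F will be the average potential over all
  one-index deletions at the new barrier, it says that this average does not exceed the old
  potential.\<close>

lemma barrier_shift:
  fixes l :: "nat \<Rightarrow> real"
  assumes n: "n \<ge> 2" and l: "\<And>i. i < n \<Longrightarrow> b < l i"
  defines "\<Phi> \<equiv> \<Sum>i<n. 1 / (l i - b)"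
  defines "b' \<equiv> b + 1 / \<Phi>"
  defines "F \<equiv> \<Sum>i<n. 1 / (l i - b')"
  shows "\<Phi> > 0" and "\<And>i. i < n \<Longrightarrow> b' < l i"
    and "(F - \<Phi>) * F \<le> (\<Sum>i<n. 1 / (l i - b')\<^sup>2)"
proof -
  have less: "1 / (l i - b) < \<Phi>" if i: "i < n" for i
  proof -
    \<comment> \<open>A second index exists because \<open>n \<ge> 2\<close>. Its positive summand
      makes the inequality strict, so the shift stays strictly below every gap.\<close>
    obtain j where j: "j < n" "j \<noteq> i"
      using n that[of "if i = 0 then 1 else 0"] by (auto split: if_splits)
    have "(\<Sum>k\<in>{i, j}. 1 / (l k - b)) \<le> \<Phi>"
      unfolding \<Phi>_def by (rule sum_mono2) (use l j i in \<open>auto simp: less_imp_le\<close>)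
    moreover have "0 < 1 / (l j - b)" using l j by simp
    moreover have "(\<Sum>k\<in>{i, j}. 1 / (l k - b)) = 1 / (l i - b) + 1 / (l j - b)" using j by simp
    ultimately show ?thesis by linarith
  qed
  show pos: "\<Phi> > 0" using less[of 0] l[of 0] n by (auto intro: less_trans[of 0 "1 / (l 0 - b)"])
  show b': "b' < l i" if "i < n" for i
    using less[OF that] l[OF that] pos by (simp add: b'_def field_simps)
  define \<delta> where "\<delta> = 1 / \<Phi>"
  have \<delta>: "\<delta> > 0" "\<delta> * \<Phi> = 1" using pos by (auto simp: \<delta>_def)
  define u x where "u i = \<delta> / (l i - b)" and "x i = 1 / (l i - b')" for i
  \<comment> \<open>Resolvent identity between the barriers \<open>b\<close> and \<open>b'\<close>:
    the new summand \<open>x i\<close> minus the old one \<open>u i / \<delta>\<close> equals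
    \<open>u i * x i\<close>. The second identity is the first one times \<open>x i\<close>.\<close>
  have ux1: "u i + \<delta> * (u i * x i) = \<delta> * x i"
    and ux2: "u i * x i + \<delta> * (u i * (x i)\<^sup>2) = \<delta> * (x i)\<^sup>2" if "i < n" for i
  proof -
    have *: "l i - b \<noteq> 0" "l i - b' \<noteq> 0" "l i - b = (l i - b') + \<delta>"
      using l[OF that] b'[OF that] by (auto simp: b'_def \<delta>_def)
    define g where "g = l i - b'"
    have g: "g \<noteq> 0" "g + \<delta> \<noteq> 0" "u i = \<delta> / (g + \<delta>)" "x i = 1 / g" using * by (auto simp: u_def x_def g_def)
    show 1: "u i + \<delta> * (u i * x i) = \<delta> * x i"
    proof -
      have "1 + \<delta> * x i = (g + \<delta>) / g" using g by (simp add: field_simps)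
      hence "u i * (1 + \<delta> * x i) = \<delta> / g" using g by simp
      thus ?thesis using g by (simp add: distrib_left mult.left_commute)
    qed
    show "u i * x i + \<delta> * (u i * (x i)\<^sup>2) = \<delta> * (x i)\<^sup>2"
      using arg_cong[OF 1, of "\<lambda>w. w * x i"] by (simp add: algebra_simps power2_eq_square)
  qed
  \<comment> \<open>The weights \<open>u\<close> sum to \<open>1\<close> by the choice of \<open>\<delta>\<close>, and the claim says that \<open>x\<close> has nonnegative variance.\<close>
  define m where "m = (\<Sum>i<n. u i * x i)"
  have sum_u: "(\<Sum>i<n. u i) = 1"
    using \<delta>(2) by (simp add: u_def \<Phi>_def sum_distrib_left)
  have u0: "u i \<ge> 0" if "i < n" for i using l[OF that] \<delta> by (simp add: u_def)
  have "(\<Sum>i<n. u i) + \<delta> * m = \<delta> * (\<Sum>i<n. x i)"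
    unfolding m_def sum_distrib_left sum.distrib[symmetric]
    by (intro sum.cong) (use ux1 in auto)
  hence mF: "1 + \<delta> * m = \<delta> * F" unfolding sum_u by (simp add: F_def x_def)
  hence m: "m = F - \<Phi>" using pos by (simp add: \<delta>_def field_simps)
  have "m + \<delta> * (\<Sum>i<n. u i * (x i)\<^sup>2) = \<delta> * (\<Sum>i<n. (x i)\<^sup>2)"
    unfolding m_def sum_distrib_left sum.distrib[symmetric]
    by (intro sum.cong) (use ux2 in auto)
  moreover have "m\<^sup>2 \<le> (\<Sum>i<n. u i * (x i)\<^sup>2)"
  proof -
    have "m\<^sup>2 = (\<Sum>i<n. sqrt (u i) * (sqrt (u i) * x i))\<^sup>2"
      unfolding m_def by (intro arg_cong[of _ _ "\<lambda>w. w\<^sup>2"] sum.cong) (use u0 in \<open>auto simp flip: mult.assoc\<close>)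
    also have "\<dots> \<le> (\<Sum>i<n. (sqrt (u i))\<^sup>2) * (\<Sum>i<n. (sqrt (u i) * x i)\<^sup>2)"
      by (rule Cauchy_Schwarz_ineq_sum)
    also have "\<dots> = (\<Sum>i<n. u i * (x i)\<^sup>2)"
      using sum_u u0 by (simp add: power_mult_distrib)
    finally show ?thesis .
  qed
  ultimately have "m + \<delta> * m\<^sup>2 \<le> \<delta> * (\<Sum>i<n. (x i)\<^sup>2)"
    using \<delta>(1) by (smt (verit) mult_left_mono)
  moreover have "m + \<delta> * m\<^sup>2 = \<delta> * (m * F)"
    using arg_cong[OF mF, of "\<lambda>w. m * w"]
    by (simp add: algebra_simps power2_eq_square)
  ultimately have "m * F \<le> (\<Sum>i<n. (x i)\<^sup>2)" using \<delta>(1) by simp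
  thus "(F - \<Phi>) * F \<le> (\<Sum>i<n. 1 / (l i - b')\<^sup>2)"
    by (simp add: m x_def power_divide)
qed


text \<open>\<open>insert_index r\<close> enumerates the indices other than \<open>r\<close>, so a
  deletion becomes a reindexing, and iterated deletions compose.\<close>

lemma mat_delete_mat_upto:
  assumes "r < Suc m"
  shows "mat_delete (mat_upto (Suc m) A) r r = mat_upto m (\<lambda>i j. A (insert_index r i) (insert_index r j))"
proof (rule eq_matI)
  fix i j assume "i < dim_row (mat_upto m (\<lambda>i j. A (insert_index r i) (insert_index r j)))"
    "j < dim_col (mat_upto m (\<lambda>i j. A (insert_index r i) (insert_index r j)))"
  hence ij: "i < m" "j < m" by auto
  have "insert_index r i < Suc m" "insert_index r j < Suc m"
    using ij by (auto simp: insert_index_def)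
  thus "mat_delete (mat_upto (Suc m) A) r r $$ (i, j) =
      mat_upto m (\<lambda>i j. A (insert_index r i) (insert_index r j)) $$ (i, j)"
    using mat_delete_index[of "mat_upto (Suc m) A" m r r i j] ij assms by simp
qed (auto simp: mat_delete_def)

lemma inj_insert_index: "inj (insert_index r)"
  by (metis delete_insert_index injI)

lemma insert_index_image_subset: "insert_index r ` {..<m} \<subseteq> {..<Suc m}"
  by (auto simp: insert_index_def)

text \<open>The derivative of the characteristic polynomial \<open>p\<close> is the sum of the
  polynomials \<open>p' r\<close> of the deletions. Evaluating this identity and its derivative at
  the new barrier \<open>b'\<close> expresses the mean of the new potentials through
  \<open>F\<close> and \<open>F2\<close>, and \<open>barrier_shift\<close> bounds that mean by
  \<open>\<Phi>\<close>.\<close>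

lemma delete_one_index:
  assumes herm: "\<And>i j. A j i = cnj (A i j)" and m: "m > 0"
    and spec: "has_spectrum A (Suc m) l" and l: "\<And>i. i < Suc m \<Longrightarrow> b < l i"
  defines "\<Phi> \<equiv> \<Sum>i<Suc m. 1 / (l i - b)"
  shows "\<exists>r<Suc m. \<exists>l'. has_spectrum (\<lambda>i j. A (insert_index r i) (insert_index r j)) m l' \<and>
    (\<forall>i<m. b + 1 / \<Phi> < l' i) \<and> (\<Sum>i<m. 1 / (l' i - (b + 1 / \<Phi>))) \<le> \<Phi>"
proof -
  note [simp del] = sum.lessThan_Suc prod.lessThan_Suc
  define b' where "b' = b + 1 / \<Phi>"
  define F where "F = (\<Sum>i<Suc m. 1 / (l i - b'))"
  define F2 where "F2 = (\<Sum>i<Suc m. 1 / (l i - b')\<^sup>2)"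
  have b'_less: "b' < l i" if "i < Suc m" for i
    unfolding b'_def \<Phi>_def by (rule barrier_shift(2)) (use m l that in auto)
  have F_le: "(F - \<Phi>) * F \<le> F2"
    unfolding F_def F2_def b'_def \<Phi>_def by (rule barrier_shift(3)) (use m l in auto)
  define A' where "A' r = (\<lambda>i j. A (insert_index r i) (insert_index r j))" for r
  have herm': "A' r j i = cnj (A' r i j)" for r i j
    unfolding A'_def by (rule herm)
  have "\<exists>l'. has_spectrum (A' r) m l'" for r
    by (rule hermitian_has_spectrum) (rule herm')
  then obtain l' where l': "\<And>r. has_spectrum (A' r) m (l' r)" by metis
  obtain i0 where i0: "i0 < Suc m"
      "\<And>x. l i0 * norm_sq_upto (Suc m) x \<le> Re (inner_upto (Suc m) (mat_app A (Suc m) x) x)"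
    using spectrum_least_form[of A "Suc m" l, OF herm _ spec] by auto
  \<comment> \<open>A deletion cannot lower the least eigenvalue, which already lies above
    \<open>b'\<close>.\<close>
  have gt: "b' < l' r i" if "i < m" for r i
  proof -
    have "l i0 \<le> l' r i"
    proof (rule spectrum_lower_bound[OF l' that])
      show "l i0 * norm_sq_upto m x \<le> Re (inner_upto m (mat_app (A' r) m x) x)" for x
        unfolding A'_def
        by (rule form_compress[of "insert_index r" m "Suc m"])
          (use i0(2) insert_index_image_subset inj_insert_index[of r] in \<open>auto intro: inj_on_subset\<close>)
    qed
    thus ?thesis using b'_less[OF i0(1)] by simp
  qed
  define Q where "Q = (\<Prod>i<Suc m. b' - l i)"
  define Q' where "Q' r = (\<Prod>i<m. b' - l' r i)" for r
  define F' where "F' r = (\<Sum>i<m. 1 / (l' r i - b'))" for r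
  define p where "p = char_poly (mat_upto (Suc m) A)"
  define p' where "p' r = char_poly (mat_upto m (A' r))" for r
  have pderiv_p: "pderiv p = (\<Sum>r<Suc m. p' r)"
    unfolding p_def p'_def A'_def
    by (subst pderiv_char_poly[of _ "Suc m"]) (auto intro!: sum.cong simp: mat_delete_mat_upto)
  have dp: "poly (pderiv p) (of_real b') = of_real (- Q * F)"
      "poly (pderiv (pderiv p)) (of_real b') = of_real (Q * (F\<^sup>2 - F2))"
    unfolding p_def Q_def F_def F2_def
    by (rule has_spectrum_poly(2,3)[of A "Suc m" l b', OF spec b'_less]; assumption)+
  have dp': "poly (p' r) (of_real b') = of_real (Q' r)"
      "poly (pderiv (p' r)) (of_real b') = of_real (- Q' r * F' r)" for r
    unfolding p'_def Q'_def F'_def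
    by (rule has_spectrum_poly(1,2)[of "A' r" m "l' r" b', OF l' gt]; assumption)+
  have "complex_of_real (- Q * F) = of_real (\<Sum>r<Suc m. Q' r)"
    unfolding dp(1)[symmetric] pderiv_p poly_sum dp'(1) by simp
  hence e1: "- Q * F = (\<Sum>r<Suc m. Q' r)" by (simp only: of_real_eq_iff)
  have "complex_of_real (Q * (F\<^sup>2 - F2)) = of_real (\<Sum>r<Suc m. - Q' r * F' r)"
    unfolding dp(2)[symmetric] pderiv_p pderiv_sum poly_sum dp'(2) by simp
  hence e2: "Q * (F\<^sup>2 - F2) = (\<Sum>r<Suc m. - Q' r * F' r)" by (simp only: of_real_eq_iff)
  \<comment> \<open>\<open>Q\<close> has \<open>Suc m\<close> negative factors and
    \<open>Q' r\<close> has \<open>m\<close> of them, so their signs are opposite and the averaging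
    weights are positive.\<close>
  have sign: "(\<Prod>i<k. b' - f i) = (- 1) ^ k * (\<Prod>i<k. f i - b')" for k and f :: "nat \<Rightarrow> real"
    by (induction k) (auto simp: prod.lessThan_Suc algebra_simps)
  have Q0: "Q \<noteq> 0" unfolding Q_def using b'_less by force
  \<comment> \<open>\<open>F\<^sup>2 - F2\<close> is the average of the new potentials \<open>F' r\<close> with the weights \<open>- Q' r / Q\<close>, whose sum is \<open>F\<close>.\<close>
  have w: "- Q' r / Q > 0" for r
  proof -
    have "(\<Prod>i<Suc m. l i - b') > 0" "(\<Prod>i<m. l' r i - b') > 0"
      using b'_less gt by (auto intro!: prod_pos)
    thus ?thesis unfolding Q_def Q'_def sign
      by (cases "even m") auto
  qed
  have "\<exists>r<Suc m. F' r \<le> \<Phi>"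
  proof (rule ccontr)
    assume "\<not> (\<exists>r<Suc m. F' r \<le> \<Phi>)"
    hence big: "F' r > \<Phi>" if "r < Suc m" for r using that by auto
    have F: "F = (\<Sum>r<Suc m. - Q' r / Q)"
      using e1 Q0 by (simp add: sum_negf field_simps flip: sum_divide_distrib)
    have "F * \<Phi> = (\<Sum>r<Suc m. (- Q' r / Q) * \<Phi>)"
      unfolding F sum_distrib_right ..
    also have "\<dots> < (\<Sum>r<Suc m. (- Q' r / Q) * F' r)"
    proof (rule sum_strict_mono)
      show "- Q' r / Q * \<Phi> < - Q' r / Q * F' r" if "r \<in> {..<Suc m}" for r
        using that by (intro mult_strict_left_mono w big) simp
    qed auto
    also have "\<dots> = (\<Sum>r<Suc m. - Q' r * F' r) / Q"
      unfolding sum_divide_distrib by (intro sum.cong) auto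
    also have "\<dots> = F\<^sup>2 - F2"
      unfolding e2[symmetric] using Q0 by simp
    finally show False using F_le by (simp add: algebra_simps power2_eq_square)
  qed
  then obtain r where "r < Suc m" "F' r \<le> \<Phi>" by blast
  thus ?thesis
    using l'[of r] gt[of _ r] unfolding A'_def F'_def b'_def by blast
qed

text \<open>\<open>\<Phi>\<close> is only an upper bound for the potential so that it can stay fixed
  through the induction. The actual potential \<open>\<Psi>\<close> never exceeds it, hence each
  deletion lifts the barrier by \<open>1 / \<Psi> \<ge> 1 / \<Phi>\<close>. The map \<open>e\<close>
  composes the deletions made.\<close>

lemma delete_indices:
  assumes "\<And>i j. A j i = cnj (A i j)" and "k > 0" and "\<Phi> > 0"
    and "has_spectrum A (k + t) l" and "\<And>i. i < k + t \<Longrightarrow> b < l i"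
    and "(\<Sum>i<k + t. 1 / (l i - b)) \<le> \<Phi>"
  shows "\<exists>e l'. inj_on e {..<k} \<and> e ` {..<k} \<subseteq> {..<k + t} \<and>
    has_spectrum (\<lambda>i j. A (e i) (e j)) k l' \<and> (\<forall>i<k. b + real t / \<Phi> < l' i)"
  using assms
proof (induction t arbitrary: A l b)
  case 0
  show ?case by (intro exI[of _ id] exI[of _ l]) (use 0(4,5) in auto)
next
  case (Suc t)
  define \<Psi> where "\<Psi> = (\<Sum>i<Suc (k + t). 1 / (l i - b))"
  have \<Psi>: "\<Psi> \<le> \<Phi>" using Suc.prems(6) by (simp add: \<Psi>_def)
  have "\<Psi> > 0" unfolding \<Psi>_def by (rule sum_pos) (use Suc.prems(5) in auto)
  have "\<exists>r<Suc (k + t). \<exists>l'. has_spectrum (\<lambda>i j. A (insert_index r i) (insert_index r j)) (k + t) l' \<and>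
    (\<forall>i<k + t. b + 1 / \<Psi> < l' i) \<and> (\<Sum>i<k + t. 1 / (l' i - (b + 1 / \<Psi>))) \<le> \<Psi>"
    unfolding \<Psi>_def by (rule delete_one_index[of A, OF Suc.prems(1)]) (use Suc.prems(2,4,5) in auto)
  then obtain r l' where r: "r < Suc (k + t)"
    and l': "has_spectrum (\<lambda>i j. A (insert_index r i) (insert_index r j)) (k + t) l'"
      "\<And>i. i < k + t \<Longrightarrow> b + 1 / \<Psi> < l' i" "(\<Sum>i<k + t. 1 / (l' i - (b + 1 / \<Psi>))) \<le> \<Psi>"
    by blast
  have "(\<Sum>i<k + t. 1 / (l' i - (b + 1 / \<Psi>))) \<le> \<Phi>" using l'(3) \<Psi> by linarith
  from Suc.IH[of "\<lambda>i j. A (insert_index r i) (insert_index r j)", OF Suc.prems(1) Suc.prems(2,3) l'(1,2) this]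
  obtain e l'' where e: "inj_on e {..<k}" "e ` {..<k} \<subseteq> {..<k + t}"
    "has_spectrum (\<lambda>i j. A (insert_index r (e i)) (insert_index r (e j))) k l''"
    "\<And>i. i < k \<Longrightarrow> b + 1 / \<Psi> + real t / \<Phi> < l'' i"
    by blast
  have "1 / \<Phi> \<le> 1 / \<Psi>" using \<Psi> \<open>\<Psi> > 0\<close> by (simp add: frac_le)
  hence "b + real (Suc t) / \<Phi> < l'' i" if "i < k" for i
    using e(4)[OF that] by (simp add: add_divide_distrib)
  moreover have "inj_on (insert_index r \<circ> e) {..<k}"
    using e(1) inj_insert_index[of r] by (auto intro!: comp_inj_on intro: inj_on_subset)
  moreover have "(insert_index r \<circ> e) ` {..<k} \<subseteq> {..<k + Suc t}"
    using e(2) insert_index_image_subset[of r "k + t"] by fastforce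
  ultimately show ?case
    using e(3) by (intro exI[of _ "insert_index r \<circ> e"] exI[of _ l'']) (simp add: comp_def)
qed

subsection \<open>Submatrices of the discrete Fourier matrix\<close>

text \<open>Schur triangularisation produces a similar matrix with the prescribed eigenvalues on its
  diagonal, and the trace is invariant under cyclic permutation of the factors.\<close>

lemma spectrum_trace:
  assumes "has_spectrum A n l"
  shows "(\<Sum>i<n. complex_of_real (l i)) = (\<Sum>i<n. A i i)"
proof -
  define es where "es = map (\<lambda>i. complex_of_real (l i)) [0..<n]"
  have "char_poly (mat_upto n A) = (\<Prod>e\<leftarrow>es. [:- e, 1:])"
    using assms by (simp add: has_spectrum_def es_def prod.list_conv_set_nth lessThan_atLeast0)
  moreover obtain B P Q where "schur_decomposition (mat_upto n A) es = (B, P, Q)"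
    by (metis prod_cases3)
  ultimately have sim: "similar_mat_wit (mat_upto n A) B P Q" and diag: "diag_mat B = es"
    using schur_decomposition[of "mat_upto n A" n es B P Q] by auto
  have "mat_upto n A \<in> carrier_mat n n" by simp
  from similar_mat_witD2[OF this sim]
  have c: "B \<in> carrier_mat n n" "P \<in> carrier_mat n n" "Q \<in> carrier_mat n n"
    and QP: "Q * P = 1\<^sub>m n" and A: "mat_upto n A = P * B * Q" by auto
  define R where "R = P * B"
  have R: "R \<in> carrier_mat n n" using c by (simp add: R_def)
  have "(\<Sum>i<n. A i i) = (\<Sum>i<n. (R * Q) $$ (i, i))"
    unfolding R_def A[symmetric] by simp
  also have "\<dots> = (\<Sum>i<n. \<Sum>j<n. R $$ (i, j) * Q $$ (j, i))"
    using c R by (intro sum.cong refl) (auto simp: scalar_prod_def lessThan_atLeast0)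
  also have "\<dots> = (\<Sum>j<n. \<Sum>i<n. Q $$ (j, i) * R $$ (i, j))"
    by (subst sum.swap) (simp add: mult.commute)
  also have "\<dots> = (\<Sum>j<n. (Q * R) $$ (j, j))"
    using c R by (intro sum.cong refl) (auto simp: scalar_prod_def lessThan_atLeast0)
  also have "Q * R = B"
    using c QP by (simp add: R_def flip: assoc_mult_mat[of Q n n P n B n])
  also have "(\<Sum>j<n. B $$ (j, j)) = (\<Sum>j<n. complex_of_real (l j))"
  proof (intro sum.cong refl)
    fix j assume "j \<in> {..<n}"
    thus "B $$ (j, j) = complex_of_real (l j)"
      using arg_cong[OF diag, of "\<lambda>xs. xs ! j"] c(1) by (simp add: diag_mat_def es_def)
  qed
  finally show ?thesis by simp
qed

text \<open>The matrix is a Gram matrix, as each entry splits into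
  \<open>cis (\<theta> m * f j)\<close> times a conjugate; so its form is a sum of squared moduli.
  Taking all rows gives Parseval's identity, taking the rows \<open>J\<close> gives the
  projection.\<close>

lemma cis_gram_form:
  "inner_upto n (mat_app (\<lambda>i j. (\<Sum>m\<in>J. cis (\<theta> m * (f j - f i))) / of_nat N) n x) x =
   of_real ((\<Sum>m\<in>J. (cmod (\<Sum>j<n. x j * cis (\<theta> m * f j)))\<^sup>2) / real N)"
proof -
  have c: "cis (\<theta> m * (f j - f i)) = cis (\<theta> m * f j) * cnj (cis (\<theta> m * f i))" for m i j
    by (simp add: cis_cnj cis_mult algebra_simps)
  have sq: "complex_of_real ((cmod (\<Sum>j<n. x j * cis (\<theta> m * f j)))\<^sup>2) =
      (\<Sum>i<n. \<Sum>j<n. cis (\<theta> m * (f j - f i)) * x j * cnj (x i))" for m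
    unfolding complex_norm_square cnj_sum sum_product c
    by (subst sum.swap) (simp add: mult_ac)
  have "inner_upto n (mat_app (\<lambda>i j. (\<Sum>m\<in>J. cis (\<theta> m * (f j - f i))) / of_nat N) n x) x =
     (\<Sum>i<n. \<Sum>j<n. \<Sum>m\<in>J. cis (\<theta> m * (f j - f i)) * x j * cnj (x i)) / of_nat N"
    by (simp add: inner_upto_def mat_app_def sum_distrib_right sum_divide_distrib)
  also have "(\<Sum>i<n. \<Sum>j<n. \<Sum>m\<in>J. cis (\<theta> m * (f j - f i)) * x j * cnj (x i)) =
      (\<Sum>i<n. \<Sum>m\<in>J. \<Sum>j<n. cis (\<theta> m * (f j - f i)) * x j * cnj (x i))"
    by (intro sum.cong refl sum.swap)
  also have "\<dots> = (\<Sum>m\<in>J. \<Sum>i<n. \<Sum>j<n. cis (\<theta> m * (f j - f i)) * x j * cnj (x i))"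
    by (rule sum.swap)
  finally show ?thesis by (simp flip: sq)
qed

lemma sum_cis_root_of_unity:
  fixes i j :: nat
  assumes "i < N" "j < N"
  shows "(\<Sum>m<N. cis (2 * pi * real m / real N * (real j - real i))) = (if i = j then of_nat N else 0)"
proof (cases "i = j")
  case False
  define z where "z = cis (2 * pi * (real j - real i) / real N)"
  have N: "N > 0" using assms by simp
  \<comment> \<open>Otherwise \<open>N\<close> would divide \<open>j - i\<close>, which is nonzero
    and smaller than \<open>N\<close> in absolute value.\<close>
  have "z \<noteq> 1"
  proof
    assume "z = 1"
    hence "cos (2 * pi * (real j - real i) / real N) = 1" by (metis cis.sel(1) one_complex.sel(1) z_def)
    then obtain k :: int where "2 * pi * (real j - real i) / real N = real_of_int k * 2 * pi"
      by (auto simp: cos_one_2pi_int)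
    hence "2 * pi * (real j - real i) = 2 * pi * (real_of_int k * real N)" using N by (simp add: field_simps)
    hence "real j - real i = real_of_int k * real N" by simp
    hence "int j - int i = k * int N"
      by (metis (mono_tags, opaque_lifting) of_int_eq_iff of_int_diff of_int_mult of_int_of_nat_eq)
    hence "int N dvd int j - int i" by simp
    moreover have "\<bar>int j - int i\<bar> < int N" using assms by auto
    ultimately have "int j - int i = 0" using dvd_imp_le_int[of "int j - int i" "int N"] by (metis abs_of_nat not_le)
    with False show False by simp
  qed
  have "cis (2 * pi * real m / real N * (real j - real i)) = z ^ m" for m
    unfolding z_def Complex.DeMoivre by (rule arg_cong[of _ _ cis]) (simp add: field_simps)
  hence "(\<Sum>m<N. cis (2 * pi * real m / real N * (real j - real i))) = (\<Sum>m<N. z ^ m)"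
    by simp
  also have "\<dots> = (z ^ N - 1) / (z - 1)" using \<open>z \<noteq> 1\<close> by (rule geometric_sum)
  also have "z ^ N = cis (2 * pi * real_of_int (int j - int i))"
    unfolding z_def Complex.DeMoivre using N by simp
  also have "\<dots> = 1" by (rule cis_multiple_2pi) simp
  finally show ?thesis using False by simp
qed simp

text \<open>The columns of the unitary Fourier matrix selected by the injection \<open>e\<close> are
  orthonormal, so the Gram matrix over all \<open>N\<close> rows is the identity.\<close>

lemma dft_parseval:
  assumes "inj_on e {..<k}" "e ` {..<k} \<subseteq> {..<N}"
  shows "(\<Sum>m<N. (cmod (\<Sum>i<k. x i * cis (2 * pi * real m / real N * real (e i))))\<^sup>2) =
    real N * norm_sq_upto k x"
proof (cases "N = 0")
  case False
  have *: "(\<Sum>m<N. cis (2 * pi * real m / real N * (real (e j) - real (e i)))) / of_nat N =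
      (if j = i then 1 else 0)" if "i < k" "j < k" for i j
    using sum_cis_root_of_unity[of "e i" N "e j"] assms that False
    by (auto simp: inj_on_def image_subset_iff)
  have "inner_upto k (mat_app (\<lambda>i j. (\<Sum>m<N. cis (2 * pi * real m / real N * (real (e j) - real (e i)))) / of_nat N) k x) x
     = (\<Sum>i<k. (\<Sum>j<k. (if j = i then 1 else 0) * x j) * cnj (x i))"
    unfolding inner_upto_def mat_app_def using * by (intro sum.cong refl arg_cong2[of _ _ _ _ "(*)"]) auto
  also have "\<dots> = inner_upto k x x"
    unfolding inner_upto_def by (intro sum.cong refl) (simp add: if_distrib[of "\<lambda>u. u * _"] cong: if_cong)
  finally have "(\<Sum>m<N. (cmod (\<Sum>i<k. x i * cis (2 * pi * real m / real N * real (e i))))\<^sup>2) / real N =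
      norm_sq_upto k x"
    unfolding cis_gram_form[where J = "{..<N}" and f = "\<lambda>i. real (e i)"] inner_upto_self
    by (simp only: of_real_eq_iff)
  thus ?thesis using False by (simp add: field_simps)
qed (use assms in \<open>auto simp: norm_sq_upto_def\<close>)

text \<open>The matrix \<open>P\<close> has spectrum in [0, 1] and trace \<open>n = card J\<close>.
  Starting from the barrier \<open>- a\<close> with potential at most \<open>\<Phi>\<close>, the
  \<open>N - k\<close> deletions lift the barrier to \<open>- a + (N - k) / \<Phi>\<close>, and this
  is the constant of the statement.\<close>

lemma dft_restricted_invertibility:
  fixes q :: real
  assumes q: "0 < q" "q < 1" and J: "J \<subseteq> {..<N}" and k: "0 < k" "k \<le> N"
  shows "\<exists>e. inj_on e {..<k} \<and> e ` {..<k} \<subseteq> {..<N} \<and>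
    (\<forall>x. (1 - q) / q * ((q * real (card J) - real k) / (real N - q * real (card J))) * norm_sq_upto k x
      \<le> (\<Sum>m\<in>J. (cmod (\<Sum>i<k. x i * cis (2 * pi * real m / real N * real (e i))))\<^sup>2) / real N)"
proof -
  define n where "n = card J"
  have n: "n \<le> N" using card_mono[OF _ J] by (simp add: n_def)
  have N: "N > 0" using k by simp
  define P where "P i j = (\<Sum>m\<in>J. cis (2 * pi * real m / real N * (real j - real i))) / of_nat N" for i j
  have herm: "P j i = cnj (P i j)" for i j
  proof -
    have "cnj (cis (t * (real j - real i))) = cis (t * (real i - real j))" for t
      by (simp add: cis_cnj algebra_simps)
    thus ?thesis unfolding P_def complex_cnj_divide cnj_sum by (simp only: complex_cnj_of_nat)
  qed
  have form: "Re (inner_upto r (mat_app (\<lambda>i j. P (e i) (e j)) r x) x) =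
      (\<Sum>m\<in>J. (cmod (\<Sum>i<r. x i * cis (2 * pi * real m / real N * real (e i))))\<^sup>2) / real N" for r e x
    unfolding P_def cis_gram_form[where f = "\<lambda>i. real (e i)"]
    by simp
  obtain l where l: "has_spectrum P N l" using hermitian_has_spectrum[of P N, OF herm] by blast
  have l0: "0 \<le> l i" if "i < N" for i
    by (rule spectrum_lower_bound[OF l that]) (use form[of N id] in \<open>simp add: sum_nonneg\<close>)
  have l1: "l i \<le> 1" if "i < N" for i
  proof (rule spectrum_upper_bound[OF l that])
    fix x
    have "Re (inner_upto N (mat_app P N x) x) \<le>
        (\<Sum>m<N. (cmod (\<Sum>i<N. x i * cis (2 * pi * real m / real N * real (id i))))\<^sup>2) / real N"
      using form[of N id x] J N by (auto intro!: divide_right_mono sum_mono2)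
    also have "\<dots> = 1 * norm_sq_upto N x"
      using dft_parseval[of id N N x] N by simp
    finally show "Re (inner_upto N (mat_app P N x) x) \<le> 1 * norm_sq_upto N x" .
  qed
  have "complex_of_real (\<Sum>i<N. l i) = of_nat n"
    using spectrum_trace[OF l] N by (simp add: P_def n_def)
  hence tr: "(\<Sum>i<N. l i) = real n" by (metis of_real_eq_iff of_real_of_nat_eq)
  \<comment> \<open>For \<open>k\<close> near q^2 n this start makes the final constant close to (1
    - q)^2 n / (N - q n). For positive \<open>n\<close> that exceeds (1 - q)^2 n / N, and the
    difference is the slack spent in the theorem.\<close>
  define a where "a = (1 - q) / q"
  have a: "a > 0" "1 + a = 1 / q" using q by (auto simp: a_def field_simps)
  have la: "- a < l i" if "i < N" for i using l0[OF that] a(1) by linarith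
  define \<Phi> where "\<Phi> = (real N - real n) / a + real n / (1 + a)"
  have "real N - q * real n > 0"
  proof -
    have "q * real n \<le> q * real N" using n q by simp
    also have "\<dots> < real N" using q N by simp
    finally show ?thesis by simp
  qed
  have \<Phi>: "\<Phi> = q * (real N - q * real n) / (1 - q)"
    unfolding \<Phi>_def a(2) a_def using q by (simp add: field_simps)
  have \<Phi>pos: "\<Phi> > 0" unfolding \<Phi> using \<open>real N - q * real n > 0\<close> q by simp
  \<comment> \<open>On [0, 1] the convex function 1 / (l + a) lies below its chord. The sum of the
    chord values depends on the trace alone, and \<open>\<Phi>\<close> is the potential of
    \<open>n\<close> ones and \<open>N - n\<close> zeros.\<close>
  have "(\<Sum>i<N. 1 / (l i - (- a))) \<le> (\<Sum>i<N. (1 - l i) / a + l i / (1 + a))"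
  proof (rule sum_mono)
    fix i assume i: "i \<in> {..<N}"
    have "(1 - l i) / a + l i / (1 + a) - 1 / (l i + a) = l i * (1 - l i) / (a * (1 + a) * (l i + a))"
      using a(1) l0[of i] i by (simp add: divide_simps) (simp add: algebra_simps)
    also have "\<dots> \<ge> 0" using a(1) l0[of i] l1[of i] i by simp
    finally show "1 / (l i - (- a)) \<le> (1 - l i) / a + l i / (1 + a)" by simp
  qed
  also have "\<dots> = \<Phi>"
    by (simp add: sum.distrib sum_subtractf tr \<Phi>_def flip: sum_divide_distrib)
  finally have pot: "(\<Sum>i<k + (N - k). 1 / (l i - (- a))) \<le> \<Phi>" using k by simp
  have "\<exists>e l'. inj_on e {..<k} \<and> e ` {..<k} \<subseteq> {..<k + (N - k)} \<and>
    has_spectrum (\<lambda>i j. P (e i) (e j)) k l' \<and> (\<forall>i<k. - a + real (N - k) / \<Phi> < l' i)"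
    by (rule delete_indices[of P k \<Phi> "N - k" l, OF herm k(1) \<Phi>pos _ _ pot])
      (use l la k in auto)
  then obtain e l' where e: "inj_on e {..<k}" "e ` {..<k} \<subseteq> {..<N}"
    and l': "has_spectrum (\<lambda>i j. P (e i) (e j)) k l'" "\<And>i. i < k \<Longrightarrow> - a + real (N - k) / \<Phi> < l' i"
    using k by auto
  obtain i where i: "i < k"
    "\<And>x. l' i * norm_sq_upto k x \<le> Re (inner_upto k (mat_app (\<lambda>i j. P (e i) (e j)) k x) x)"
    using spectrum_least_form[of "\<lambda>i j. P (e i) (e j)" k l', OF herm k(1) l'(1)] by blast
  have "- a + real (N - k) / \<Phi> = (1 - q) / q * ((q * real n - real k) / (real N - q * real n))"
    unfolding \<Phi> a_def using q k \<open>real N - q * real n > 0\<close>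
    by (simp add: of_nat_diff divide_simps) (simp add: algebra_simps)
  hence "(1 - q) / q * ((q * real n - real k) / (real N - q * real n)) * norm_sq_upto k x
      \<le> l' i * norm_sq_upto k x" for x
    using l'(2)[OF i(1)] norm_sq_upto_nonneg[of k x] by (intro mult_right_mono) auto
  hence "(1 - q) / q * ((q * real n - real k) / (real N - q * real n)) * norm_sq_upto k x
      \<le> (\<Sum>m\<in>J. (cmod (\<Sum>i<k. x i * cis (2 * pi * real m / real N * real (e i))))\<^sup>2) / real N" for x
    using i(2)[of x] unfolding form by (meson order_trans)
  with e show ?thesis unfolding n_def by blast
qed

subsection \<open>Density and orthogonality\<close>

text \<open>Any \<open>N\<close> consecutive integers form a complete residue system;
  \<open>g s\<close> is the representative of the residue \<open>s\<close> in the block that starts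
  at \<open>u\<close>.\<close>

lemma card_residues_block:
  fixes u :: int
  assumes N: "N > 0" and S: "S \<subseteq> {..<N}"
  shows "card {\<gamma>. nat (\<gamma> mod int N) \<in> S \<and> u \<le> \<gamma> \<and> \<gamma> < u + int N} = card S"
proof -
  define g where "g s = u + (int s - u) mod int N" for s
  have g: "u \<le> g s" "g s < u + int N" for s using N by (auto simp: g_def)
  have gm: "nat (g s mod int N) = s" if "s \<in> S" for s
  proof -
    have "g s mod int N = int s mod int N"
      unfolding g_def by (simp add: mod_simps)
    thus ?thesis using that S by (auto simp: subset_iff)
  qed
  have "bij_betw g S {\<gamma>. nat (\<gamma> mod int N) \<in> S \<and> u \<le> \<gamma> \<and> \<gamma> < u + int N}"
  proof (rule bij_betwI[where g = "\<lambda>\<gamma>. nat (\<gamma> mod int N)"])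
    show "g (nat (\<gamma> mod int N)) = \<gamma>"
      if "\<gamma> \<in> {\<gamma>. nat (\<gamma> mod int N) \<in> S \<and> u \<le> \<gamma> \<and> \<gamma> < u + int N}" for \<gamma>
    proof -
      have "(\<gamma> mod int N - u) mod int N = (\<gamma> - u) mod int N" by (simp add: mod_simps)
      also have "\<dots> = \<gamma> - u" using that by simp
      finally show ?thesis using N by (simp add: g_def)
    qed
    show "g \<in> S \<rightarrow> {\<gamma>. nat (\<gamma> mod int N) \<in> S \<and> u \<le> \<gamma> \<and> \<gamma> < u + int N}"
      by (intro Pi_I) (simp add: g gm)
  qed (auto simp: gm)
  from bij_betw_same_card[OF this] show ?thesis by simp
qed

lemma card_residues_blocks:
  fixes u :: int
  assumes N: "N > 0" and S: "S \<subseteq> {..<N}"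
  shows "card {\<gamma>. nat (\<gamma> mod int N) \<in> S \<and> u \<le> \<gamma> \<and> \<gamma> < u + int N * int t} = t * card S"
proof (induction t)
  case (Suc t)
  define w where "w = int N * int t"
  have w: "0 \<le> w" "int N * int (Suc t) = w + int N" by (auto simp: w_def algebra_simps)
  let ?A = "{\<gamma>. nat (\<gamma> mod int N) \<in> S \<and> u \<le> \<gamma> \<and> \<gamma> < u + w}"
  let ?B = "{\<gamma>. nat (\<gamma> mod int N) \<in> S \<and> u + w \<le> \<gamma> \<and> \<gamma> < (u + w) + int N}"
  have "{\<gamma>. nat (\<gamma> mod int N) \<in> S \<and> u \<le> \<gamma> \<and> \<gamma> < u + int N * int (Suc t)} = ?A \<union> ?B"
    unfolding w(2) using w(1) by auto
  moreover have "finite ?A" by (rule finite_subset[of _ "{u..<u + w}"]) auto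
  moreover have "finite ?B" by (rule finite_subset[of _ "{u + w..<(u + w) + int N}"]) auto
  moreover have "?A \<inter> ?B = {}" by auto
  ultimately show ?case
    using Suc[folded w_def] card_residues_block[OF N S, of "u + w"] by (simp add: card_Un_disjoint)
qed simp

text \<open>A window of length \<open>r\<close> contains \<open>t\<close> full periods,
  \<open>t\<close> the integer part of r / N, and is covered by \<open>t + 1\<close> of them. So its
  count differs from r c / N by at most \<open>c\<close>, uniformly in the position
  \<open>x\<close>, and dividing by \<open>r\<close> gives both limits.\<close>

lemma residues_uniform_density:
  assumes N: "N > 0" and S: "S \<subseteq> {..<N}"
  shows "has_uniform_density {\<gamma>. nat (\<gamma> mod int N) \<in> S} (real (card S) / real N)"
proof -
  define \<Gamma> where "\<Gamma> = {\<gamma>. nat (\<gamma> mod int N) \<in> S}"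
  define c where "c = real (card S)"
  have bounds: "(r / real N - 1) * c \<le> count_in \<Gamma> x r" "count_in \<Gamma> x r \<le> (r / real N + 1) * c"
    if r: "r \<ge> 0" for x r
  proof -
    define u where "u = \<lceil>x\<rceil>"
    define t where "t = nat \<lfloor>r / real N\<rfloor>"
    have t: "real t \<le> r / real N" "r / real N < real t + 1"
      using r by (auto simp: t_def)
    have tN: "real N * real t \<le> r" "r < real N * (real t + 1)" using t N by (auto simp: field_simps)
    let ?X = "{\<gamma>\<in>\<Gamma>. x \<le> real_of_int \<gamma> \<and> real_of_int \<gamma> \<le> x + r}"
    let ?Y = "\<lambda>t. {\<gamma>. nat (\<gamma> mod int N) \<in> S \<and> u \<le> \<gamma> \<and> \<gamma> < u + int N * int t}"
    have u: "x \<le> real_of_int u" "real_of_int u < x + 1" unfolding u_def by linarith+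
    \<comment> \<open>The last integer of \<open>t\<close> blocks is at most
      \<open>u + N * t - 1\<close>, and \<open>u - 1 < x\<close> keeps it inside the window.\<close>
    have "?Y t \<subseteq> ?X"
    proof
      fix \<gamma> assume \<gamma>: "\<gamma> \<in> ?Y t"
      hence "\<gamma> \<le> u + int N * int t - 1" by simp
      hence "real_of_int \<gamma> \<le> real_of_int (u + int N * int t - 1)" by (simp only: of_int_le_iff)
      moreover have "real_of_int u \<le> real_of_int \<gamma>" using \<gamma> by simp
      ultimately show "\<gamma> \<in> ?X" using u tN \<gamma> by (simp add: \<Gamma>_def)
    qed
    moreover have sub: "?X \<subseteq> ?Y (Suc t)"
    proof
      fix \<gamma> assume \<gamma>: "\<gamma> \<in> ?X"
      hence "u \<le> \<gamma>" by (simp add: u_def ceiling_le_iff)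
      moreover have "real_of_int \<gamma> < real_of_int (u + int N * int (Suc t))"
        using \<gamma> tN u by (simp add: algebra_simps)
      hence "\<gamma> < u + int N * int (Suc t)" by (simp only: of_int_less_iff)
      ultimately show "\<gamma> \<in> ?Y (Suc t)" using \<gamma> by (simp add: \<Gamma>_def)
    qed
    moreover have fin: "finite (?Y (Suc t))"
      by (rule finite_subset[of _ "{u..<u + int N * int (Suc t)}"]) auto
    ultimately have "card (?Y t) \<le> card ?X" "card ?X \<le> card (?Y (Suc t))"
      by (meson card_mono finite_subset)+
    hence le: "t * card S \<le> card ?X" "card ?X \<le> Suc t * card S"
      unfolding card_residues_blocks[OF N S] .
    have "(r / real N - 1) * c \<le> real t * c" using t by (intro mult_right_mono) (auto simp: c_def)
    also have "\<dots> \<le> count_in \<Gamma> x r"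
      using of_nat_mono[OF le(1), where 'a = real] by (simp add: count_in_def c_def)
    finally show "(r / real N - 1) * c \<le> count_in \<Gamma> x r" .
    have "count_in \<Gamma> x r \<le> real (Suc t) * c"
      using of_nat_mono[OF le(2), where 'a = real] by (simp add: count_in_def c_def algebra_simps)
    also have "\<dots> \<le> (r / real N + 1) * c" using t by (intro mult_right_mono) (auto simp: c_def)
    finally show "count_in \<Gamma> x r \<le> (r / real N + 1) * c" .
  qed
  have lims: "((\<lambda>r. (r / real N - 1) * c / r) \<longlongrightarrow> c / real N) at_top"
    "((\<lambda>r. (r / real N + 1) * c / r) \<longlongrightarrow> c / real N) at_top"
  proof -
    have "((\<lambda>r. c / real N - c / r) \<longlongrightarrow> c / real N - 0) at_top"
      "((\<lambda>r. c / real N + c / r) \<longlongrightarrow> c / real N + 0) at_top"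
      by (intro tendsto_diff tendsto_add tendsto_const
          real_tendsto_divide_at_top[OF tendsto_const filterlim_ident])+
    moreover have "\<forall>\<^sub>F r in at_top. c / real N - c / r = (r / real N - 1) * c / r"
      "\<forall>\<^sub>F r in at_top. c / real N + c / r = (r / real N + 1) * c / r"
      by (intro eventually_mono[OF eventually_gt_at_top[of 0]]; simp add: field_simps)+
    ultimately show "((\<lambda>r. (r / real N - 1) * c / r) \<longlongrightarrow> c / real N) at_top"
      "((\<lambda>r. (r / real N + 1) * c / r) \<longlongrightarrow> c / real N) at_top"
      by (auto intro: Lim_transform_eventually)
  qed
  have inf: "(r / real N - 1) * c \<le> (INF x. count_in \<Gamma> x r)" "(INF x. count_in \<Gamma> x r) \<le> (r / real N + 1) * c"
    and sup: "(r / real N - 1) * c \<le> (SUP x. count_in \<Gamma> x r)" "(SUP x. count_in \<Gamma> x r) \<le> (r / real N + 1) * c"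
    if r: "r \<ge> 0" for r
  proof -
    note b = bounds[OF r]
    have bdd: "bdd_below (range (\<lambda>x. count_in \<Gamma> x r))" "bdd_above (range (\<lambda>x. count_in \<Gamma> x r))"
      using b by (auto intro!: bdd_belowI bdd_aboveI)
    show "(r / real N - 1) * c \<le> (INF x. count_in \<Gamma> x r)" by (rule cINF_greatest) (auto intro: b)
    show "(SUP x. count_in \<Gamma> x r) \<le> (r / real N + 1) * c" by (rule cSUP_least) (auto intro: b)
    show "(INF x. count_in \<Gamma> x r) \<le> (r / real N + 1) * c"
      using cINF_lower[OF bdd(1), of 0] b(2)[of 0] by simp
    show "(r / real N - 1) * c \<le> (SUP x. count_in \<Gamma> x r)"
      using cSUP_upper[OF _ bdd(2), of 0] b(1)[of 0] by simp
  qed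
  have "((\<lambda>r. (INF x. count_in \<Gamma> x r) / r) \<longlongrightarrow> c / real N) at_top"
    by (rule tendsto_sandwich[OF _ _ lims])
      (auto intro!: eventually_mono[OF eventually_gt_at_top[of 0]] divide_right_mono inf)
  moreover have "((\<lambda>r. (SUP x. count_in \<Gamma> x r) / r) \<longlongrightarrow> c / real N) at_top"
    by (rule tendsto_sandwich[OF _ _ lims])
      (auto intro!: eventually_mono[OF eventually_gt_at_top[of 0]] divide_right_mono sup)
  ultimately show ?thesis by (simp add: has_uniform_density_def \<Gamma>_def c_def)
qed

section \<open>Orthogonality of exponentials and Parseval's identity for trigonometric
  polynomials\<close>

lemma exp_integral:
  fixes k :: int
  shows "(LINT t:{0..2*pi}|lborel. exp (\<i> * of_int k * complex_of_real t)) = (if k = 0 then of_real (2 * pi) else 0)"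
proof -
  have cont: "continuous_on {0..2*pi} (\<lambda>t. exp (\<i> * of_int k * complex_of_real t))"
    by (intro continuous_intros)
  have "(LINT t:{0..2*pi}|lborel. exp (\<i> * of_int k * complex_of_real t)) =
      integral {0..2*pi} (\<lambda>t. exp (\<i> * of_int k * complex_of_real t))"
    by (intro set_borel_integral_eq_integral borel_integrable_atLeastAtMost' cont)
  also have "\<dots> = (if k = 0 then of_real (2 * pi) else 0)"
  proof (cases "k = 0")
    case False
    have "((\<lambda>t. exp (\<i> * of_int k * complex_of_real t)) has_integral
       (exp (\<i> * of_int k * complex_of_real (2 * pi)) / (\<i> * of_int k) -
        exp (\<i> * of_int k * complex_of_real 0) / (\<i> * of_int k))) {0..2*pi}"
    proof (rule fundamental_theorem_of_calculus)
      fix t assume "t \<in> {0..2*pi}"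
      have "((\<lambda>z. exp (\<i> * of_int k * z) / (\<i> * of_int k)) has_field_derivative
          exp (\<i> * of_int k * complex_of_real t)) (at (complex_of_real t))"
        using False by (auto intro!: derivative_eq_intros)
      thus "((\<lambda>t. exp (\<i> * of_int k * complex_of_real t) / (\<i> * of_int k)) has_vector_derivative
          exp (\<i> * of_int k * complex_of_real t)) (at t within {0..2*pi})"
        by (rule has_vector_derivative_real_field)
    qed simp
    moreover have "exp (\<i> * of_int k * complex_of_real (2 * pi)) = 1"
      using exp_integer_2pi[of "of_int k"] by (simp add: mult_ac)
    ultimately have "((\<lambda>t. exp (\<i> * of_int k * complex_of_real t)) has_integral 0) {0..2*pi}"
      by simp
    thus ?thesis using False by (simp add: integral_unique)
  qed (simp add: scaleR_conv_of_real)
  finally show ?thesis .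
qed

lemma trig_poly_norm_sq:
  assumes "finite G"
  shows "(LINT t:{0..2*pi}|lborel. (cmod (\<Sum>\<gamma>\<in>G. a \<gamma> * exp (\<i> * of_int \<gamma> * of_real t)))\<^sup>2) =
    2 * pi * (\<Sum>\<gamma>\<in>G. (cmod (a \<gamma>))\<^sup>2)"
proof -
  define E where "E k t = exp (\<i> * of_int k * complex_of_real t)" for k :: int and t
  have int: "set_integrable lborel {0..2*pi} (\<lambda>t. c * E k t)" for c k
    unfolding E_def by (intro borel_integrable_atLeastAtMost' continuous_intros)
  have EI: "(LINT t:{0..2*pi}|lborel. E k t) = (if k = 0 then of_real (2 * pi) else 0)" for k
    unfolding E_def by (rule exp_integral)
  have sq: "complex_of_real ((cmod (\<Sum>\<gamma>\<in>G. a \<gamma> * E \<gamma> t))\<^sup>2) =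
      (\<Sum>\<gamma>\<in>G. \<Sum>\<eta>\<in>G. a \<gamma> * cnj (a \<eta>) * E (\<gamma> - \<eta>) t)" for t
  proof -
    have "E \<gamma> t * cnj (E \<eta> t) = E (\<gamma> - \<eta>) t" for \<gamma> \<eta>
      by (simp add: E_def exp_cnj exp_add[symmetric] algebra_simps)
    hence "a \<gamma> * E \<gamma> t * cnj (a \<eta> * E \<eta> t) = a \<gamma> * cnj (a \<eta>) * E (\<gamma> - \<eta>) t" for \<gamma> \<eta>
      by (metis complex_cnj_mult mult.assoc mult.left_commute)
    thus ?thesis unfolding complex_norm_square cnj_sum sum_product by (simp only:)
  qed
  have "complex_of_real (LINT t:{0..2*pi}|lborel. (cmod (\<Sum>\<gamma>\<in>G. a \<gamma> * E \<gamma> t))\<^sup>2) =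
      (LINT t:{0..2*pi}|lborel. complex_of_real ((cmod (\<Sum>\<gamma>\<in>G. a \<gamma> * E \<gamma> t))\<^sup>2))"
    by (rule set_integral_complex_of_real[symmetric])
  also have "\<dots> = (\<Sum>\<gamma>\<in>G. \<Sum>\<eta>\<in>G. (LINT t:{0..2*pi}|lborel. a \<gamma> * cnj (a \<eta>) * E (\<gamma> - \<eta>) t))"
    unfolding sq using int[unfolded set_integrable_def]
    by (simp add: set_lebesgue_integral_def scaleR_sum_right Bochner_Integration.integral_sum
        del: set_integral_mult_right)
  also have "\<dots> = (\<Sum>\<gamma>\<in>G. \<Sum>\<eta>\<in>G. if \<gamma> = \<eta> then of_real (2 * pi) * (a \<gamma> * cnj (a \<gamma>)) else 0)"
    by (intro sum.cong refl) (simp add: EI)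
  also have "\<dots> = complex_of_real (2 * pi * (\<Sum>\<gamma>\<in>G. (cmod (a \<gamma>))\<^sup>2))"
    using assms by (simp add: sum_distrib_left complex_norm_square del: of_real_power)
  finally show ?thesis unfolding E_def of_real_eq_iff .
qed

subsection \<open>Square-summable trigonometric series\<close>

lemma finite_window: "finite {\<gamma>\<in>\<Gamma>. \<bar>\<gamma>\<bar> \<le> int N}"
  by (rule finite_subset[of _ "{- int N..int N}"]) auto

lemma partial_exp_sum_continuous: "continuous_on S (partial_exp_sum \<Gamma> a N)"
  unfolding partial_exp_sum_def[abs_def] by (intro continuous_intros)

lemma partial_exp_sum_measurable [measurable]: "partial_exp_sum \<Gamma> a N \<in> borel_measurable borel"
  by (intro borel_measurable_continuous_onI partial_exp_sum_continuous)

text \<open>The symmetric windows eventually contain every finite subset of \<open>\<Gamma>\<close>,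
  so the unordered sum is also the limit along them.\<close>

lemma window_sum_tendsto:
  assumes "(\<lambda>\<gamma>. (cmod (a \<gamma>))\<^sup>2) summable_on \<Gamma>"
  shows "(\<lambda>N. \<Sum>\<gamma>\<in>{\<gamma>\<in>\<Gamma>. \<bar>\<gamma>\<bar> \<le> int N}. (cmod (a \<gamma>))\<^sup>2) \<longlonglongrightarrow> (\<Sum>\<^sub>\<infinity>\<gamma>\<in>\<Gamma>. (cmod (a \<gamma>))\<^sup>2)"
proof -
  have "filterlim (\<lambda>N. {\<gamma>\<in>\<Gamma>. \<bar>\<gamma>\<bar> \<le> int N}) (finite_subsets_at_top \<Gamma>) sequentially"
    unfolding filterlim_finite_subsets_at_top
  proof safe
    fix X assume X: "finite X" "X \<subseteq> \<Gamma>"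
    obtain M where M: "\<And>\<gamma>. \<gamma> \<in> X \<Longrightarrow> nat \<bar>\<gamma>\<bar> \<le> M"
      using finite_nat_set_iff_bounded_le[of "(\<lambda>\<gamma>. nat \<bar>\<gamma>\<bar>) ` X"] X(1) by auto
    show "\<forall>\<^sub>F N in sequentially. finite {\<gamma>\<in>\<Gamma>. \<bar>\<gamma>\<bar> \<le> int N} \<and> X \<subseteq> {\<gamma>\<in>\<Gamma>. \<bar>\<gamma>\<bar> \<le> int N} \<and> {\<gamma>\<in>\<Gamma>. \<bar>\<gamma>\<bar> \<le> int N} \<subseteq> \<Gamma>"
      using eventually_ge_at_top[of M]
    proof eventually_elim
      case (elim N)
      thus ?case using X M finite_window by fastforce
    qed
  qed
  with has_sum_infsum[OF assms, unfolded has_sum_def] show ?thesis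
    by (rule filterlim_compose)
qed

lemma partial_exp_sum_diff:
  assumes "M \<le> N"
  shows "(LINT t:{0..2*pi}|lborel. (cmod (partial_exp_sum \<Gamma> a N t - partial_exp_sum \<Gamma> a M t))\<^sup>2) =
    2 * pi * ((\<Sum>\<gamma>\<in>{\<gamma>\<in>\<Gamma>. \<bar>\<gamma>\<bar> \<le> int N}. (cmod (a \<gamma>))\<^sup>2) - (\<Sum>\<gamma>\<in>{\<gamma>\<in>\<Gamma>. \<bar>\<gamma>\<bar> \<le> int M}. (cmod (a \<gamma>))\<^sup>2))"
proof -
  let ?G = "\<lambda>N. {\<gamma>\<in>\<Gamma>. \<bar>\<gamma>\<bar> \<le> int N}"
  have sub: "?G M \<subseteq> ?G N" using assms by auto
  have d: "sum f (?G N) - sum f (?G M) = sum f (?G N - ?G M)" for f :: "int \<Rightarrow> 'z::ab_group_add"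
    using sum_diff[OF finite_window sub, of f] by simp
  show ?thesis
    unfolding partial_exp_sum_def d by (rule trig_poly_norm_sq) (simp add: finite_window)
qed

lemma ennreal_le_suminf: "f k \<le> (\<Sum>k. f k)" for f :: "nat \<Rightarrow> ennreal"
  using sum_le_suminf[of f "{k}"] by (simp add: summableI)

text \<open>Riesz-Fischer carried out directly: a fast subsequence of the partial sums converges
  almost everywhere on the period, and Fatou's lemma bounds the distance of its limit from the
  \<open>N\<close>-th partial sum by the tail \<open>\<tau> N\<close> of the coefficients.\<close>

lemma L2_sum_exists:
  assumes "(\<lambda>\<gamma>. (cmod (a \<gamma>))\<^sup>2) summable_on \<Gamma>"
  shows "\<exists>f. is_L2_sum \<Gamma> a f"
proof -
  define S where "S = partial_exp_sum \<Gamma> a"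
  define \<sigma> where "\<sigma> N = (\<Sum>\<gamma>\<in>{\<gamma>\<in>\<Gamma>. \<bar>\<gamma>\<bar> \<le> int N}. (cmod (a \<gamma>))\<^sup>2)" for N
  define \<tau> where "\<tau> N = (\<Sum>\<^sub>\<infinity>\<gamma>\<in>\<Gamma>. (cmod (a \<gamma>))\<^sup>2) - \<sigma> N" for N
  have meas [measurable]: "S N \<in> borel_measurable borel" for N by (simp add: S_def)
  have \<sigma>: "\<sigma> \<longlonglongrightarrow> (\<Sum>\<^sub>\<infinity>\<gamma>\<in>\<Gamma>. (cmod (a \<gamma>))\<^sup>2)"
    unfolding \<sigma>_def[abs_def] by (rule window_sum_tendsto[OF assms])
  have \<sigma>_mono: "incseq \<sigma>"
    unfolding \<sigma>_def[abs_def] incseq_def by (intro allI impI sum_mono2 finite_window) auto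
  have \<sigma>_le: "\<sigma> N \<le> (\<Sum>\<^sub>\<infinity>\<gamma>\<in>\<Gamma>. (cmod (a \<gamma>))\<^sup>2)" for N
    using incseq_le[OF \<sigma>_mono \<sigma>] .
  have \<tau>0: "\<tau> \<longlonglongrightarrow> 0"
    using tendsto_diff[OF tendsto_const[of "\<Sum>\<^sub>\<infinity>\<gamma>\<in>\<Gamma>. (cmod (a \<gamma>))\<^sup>2"] \<sigma>]
    unfolding \<tau>_def[abs_def] by simp
  have diff_int: "set_integrable lborel {0..2*pi} (\<lambda>t. (cmod (S N t - S M t))\<^sup>2)" for N M
    unfolding S_def by (intro borel_integrable_atLeastAtMost' continuous_intros partial_exp_sum_continuous)
  have diff_le: "(\<integral>\<^sup>+t. ennreal ((cmod (S N t - S M t))\<^sup>2) * indicator {0..2*pi} t \<partial>lborel) \<le> ennreal (2 * pi * \<tau> M)"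
    if "M \<le> N" for M N
  proof -
    have "(\<integral>\<^sup>+t. ennreal ((cmod (S N t - S M t))\<^sup>2) * indicator {0..2*pi} t \<partial>lborel) =
        (\<integral>\<^sup>+t. ennreal (indicator {0..2*pi} t *\<^sub>R (cmod (S N t - S M t))\<^sup>2) \<partial>lborel)"
      by (intro nn_integral_cong) (auto split: split_indicator)
    also have "\<dots> = ennreal (LINT t:{0..2*pi}|lborel. (cmod (S N t - S M t))\<^sup>2)"
      unfolding set_lebesgue_integral_def
      by (intro nn_integral_eq_integral diff_int[unfolded set_integrable_def]) auto
    also have "\<dots> = ennreal (2 * pi * (\<sigma> N - \<sigma> M))"
      unfolding S_def \<sigma>_def by (simp add: partial_exp_sum_diff[OF that])
    also have "\<dots> \<le> ennreal (2 * pi * \<tau> M)"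
      using \<sigma>_le[of N] by (intro ennreal_leI mult_left_mono) (auto simp: \<tau>_def)
    finally show ?thesis .
  qed
  have "\<exists>M. \<forall>N\<ge>M. \<tau> N \<le> (1/8) ^ k" for k
  proof -
    have "\<forall>\<^sub>F N in sequentially. \<tau> N < (1/8) ^ k"
      using \<tau>0 by (rule order_tendstoD(2)) simp
    thus ?thesis unfolding eventually_sequentially by (meson less_imp_le)
  qed
  then obtain M where M: "\<And>k N. N \<ge> M k \<Longrightarrow> \<tau> N \<le> (1/8) ^ k" by metis
  \<comment> \<open>Summing all earlier \<open>M j\<close> makes \<open>K\<close> monotone and at
    least \<open>M k\<close>; the extra \<open>k\<close> makes it tend to infinity.\<close>
  define K where "K k = k + (\<Sum>j\<le>k. M j)" for k
  have K: "K k \<le> K (Suc k)" "M k \<le> K k" "k \<le> K k" for k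
  proof -
    have "M k \<le> (\<Sum>j\<le>k. M j)" by (rule member_le_sum) auto
    thus "K k \<le> K (Suc k)" "M k \<le> K k" "k \<le> K k" by (auto simp: K_def)
  qed
  \<comment> \<open>The weight 4^k is balanced between two demands. Against the decay 8^(-k) the
    integrals still sum geometrically, while finiteness of the sum at \<open>t\<close> forces the
    increments below a multiple of 2^(-k).\<close>
  define u where "u k t = ennreal (4 ^ k * (cmod (S (K (Suc k)) t - S (K k) t))\<^sup>2) * indicator {0..2*pi} t" for k t
  have u_meas [measurable]: "u k \<in> borel_measurable borel" for k
    unfolding u_def[abs_def] by measurable
  have u_le: "(\<integral>\<^sup>+t. u k t \<partial>lborel) \<le> ennreal (2 * pi * (1/2) ^ k)" for k
  proof -
    have "(\<integral>\<^sup>+t. u k t \<partial>lborel) =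
        ennreal (4 ^ k) * (\<integral>\<^sup>+t. ennreal ((cmod (S (K (Suc k)) t - S (K k) t))\<^sup>2) * indicator {0..2*pi} t \<partial>lborel)"
      unfolding u_def by (subst nn_integral_cmult[symmetric]) (auto simp: ennreal_mult' mult.assoc)
    also have "\<dots> \<le> ennreal (4 ^ k) * ennreal (2 * pi * \<tau> (K k))"
      by (intro mult_left_mono diff_le K) auto
    also have "\<dots> = ennreal (4 ^ k * (2 * pi * \<tau> (K k)))"
      by (simp add: ennreal_mult')
    also have "\<dots> \<le> ennreal (4 ^ k * (2 * pi * (1/8) ^ k))"
      by (intro ennreal_leI mult_left_mono M K) auto
    also have "4 ^ k * (2 * pi * (1/8) ^ k) = 2 * pi * ((4 * (1/8)) ^ k :: real)"
      unfolding power_mult_distrib by simp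
    finally show ?thesis by simp
  qed
  have "(\<integral>\<^sup>+t. (\<Sum>k. u k t) \<partial>lborel) = (\<Sum>k. \<integral>\<^sup>+t. u k t \<partial>lborel)"
    by (rule nn_integral_suminf) simp
  also have "\<dots> \<le> (\<Sum>k. ennreal (2 * pi * (1/2) ^ k))"
    by (intro suminf_le u_le) auto
  also have "\<dots> < \<infinity>"
  proof -
    have "(\<lambda>k. 2 * pi * (1/2) ^ k) sums (2 * pi * (1 / (1 - 1/2)))"
      by (intro sums_mult geometric_sums) simp
    hence eq: "(\<Sum>k. ennreal (2 * pi * (1/2) ^ k)) = ennreal (2 * pi * (1 / (1 - 1/2)))"
      by (rule suminf_ennreal_eq[rotated]) simp
    show ?thesis unfolding eq infinity_ennreal_def by (rule ennreal_less_top)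
  qed
  finally have "(\<integral>\<^sup>+t. (\<Sum>k. u k t) \<partial>lborel) \<noteq> \<infinity>" by (rule less_imp_neq)
  hence "AE t in lborel. (\<Sum>k. u k t) \<noteq> \<infinity>"
    by (rule nn_integral_noteq_infinite[rotated]) measurable
  moreover have conv: "convergent (\<lambda>k. S (K k) t)"
    if fin: "(\<Sum>k. u k t) \<noteq> \<infinity>" and t: "t \<in> {0..2*pi}" for t
  proof -
    define C where "C = enn2real (\<Sum>k. u k t)"
    have C: "(\<Sum>k. u k t) = ennreal C"
      using fin unfolding C_def infinity_ennreal_def less_top by (rule ennreal_enn2real[symmetric])
    have C0: "C \<ge> 0" unfolding C_def by (rule enn2real_nonneg)
    have "cmod (S (K (Suc k)) t - S (K k) t) \<le> sqrt C * (1/2) ^ k" for k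
    proof -
      have "u k t \<le> ennreal C"
        unfolding C[symmetric] by (rule ennreal_le_suminf)
      hence "ennreal (4 ^ k * (cmod (S (K (Suc k)) t - S (K k) t))\<^sup>2) \<le> ennreal C"
        using t by (simp add: u_def)
      hence "4 ^ k * (cmod (S (K (Suc k)) t - S (K k) t))\<^sup>2 \<le> C" using C0 by simp
      hence "(cmod (S (K (Suc k)) t - S (K k) t))\<^sup>2 \<le> C * (1/4) ^ k"
        by (simp add: field_simps)
      hence "cmod (S (K (Suc k)) t - S (K k) t) \<le> sqrt (C * (1/4) ^ k)"
        by (rule real_le_rsqrt)
      also have "(1/4::real) ^ k = ((1/2) ^ k)\<^sup>2" by (simp add: power2_eq_square flip: power_mult_distrib)
      finally show ?thesis by (simp add: real_sqrt_mult)
    qed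
    hence "summable (\<lambda>k. S (K (Suc k)) t - S (K k) t)"
      by (rule summable_comparison_test'[of "\<lambda>k. sqrt C * (1/2) ^ k" 0, rotated])
        (intro summable_mult summable_geometric, simp)
    from summable_LIMSEQ[OF this]
    have "(\<lambda>n. S (K n) t - S (K 0) t) \<longlonglongrightarrow> (\<Sum>k. S (K (Suc k)) t - S (K k) t)"
      unfolding sum_lessThan_telescope[of "\<lambda>k. S (K k) t"] .
    from tendsto_add[OF this tendsto_const[of "S (K 0) t"]] show ?thesis
      by (simp add: convergentI)
  qed
  ultimately have ae: "AE t in lborel. t \<in> {0..2*pi} \<longrightarrow> convergent (\<lambda>k. S (K k) t)"
    by (elim eventually_mono) blast
  \<comment> \<open>Where the sequence diverges, \<open>lim\<close> supplies a default value; inside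
    the period this happens only on a null set.\<close>
  define f where "f t = lim (\<lambda>k. S (K k) t)" for t
  have f_meas [measurable]: "f \<in> borel_measurable borel"
    unfolding f_def[abs_def] by measurable
  have f_le: "(\<integral>\<^sup>+t. ennreal ((cmod (f t - S N t))\<^sup>2) * indicator {0..2*pi} t \<partial>lborel) \<le> ennreal (2 * pi * \<tau> N)" for N
  proof -
    let ?v = "\<lambda>k t. ennreal ((cmod (S (K k) t - S N t))\<^sup>2) * indicator {0..2*pi} t"
    have "AE t in lborel. ennreal ((cmod (f t - S N t))\<^sup>2) * indicator {0..2*pi} t = liminf (\<lambda>k. ?v k t)"
      using ae
    proof eventually_elim
      case (elim t)
      show ?case
      proof (cases "t \<in> {0..2*pi}")
        case True
        hence "(\<lambda>k. S (K k) t) \<longlonglongrightarrow> f t"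
          using elim unfolding f_def convergent_LIMSEQ_iff by blast
        hence "(\<lambda>k. ennreal ((cmod (S (K k) t - S N t))\<^sup>2)) \<longlonglongrightarrow> ennreal ((cmod (f t - S N t))\<^sup>2)"
          by (intro tendsto_ennrealI tendsto_intros)
        from lim_imp_Liminf[OF _ this] True show ?thesis by simp
      qed (simp add: Liminf_const)
    qed
    hence "(\<integral>\<^sup>+t. ennreal ((cmod (f t - S N t))\<^sup>2) * indicator {0..2*pi} t \<partial>lborel) =
        (\<integral>\<^sup>+t. liminf (\<lambda>k. ?v k t) \<partial>lborel)"
      by (rule nn_integral_cong_AE)
    also have "\<dots> \<le> liminf (\<lambda>k. \<integral>\<^sup>+t. ?v k t \<partial>lborel)"
      by (rule nn_integral_liminf) measurable
    \<comment> \<open>The Cauchy bound \<open>diff_le\<close> requires \<open>N \<le> K k\<close>,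
      so it is available only for large \<open>k\<close>, which suffices for the upper
      limit.\<close>
    also have "\<dots> \<le> limsup (\<lambda>k. \<integral>\<^sup>+t. ?v k t \<partial>lborel)"
      by (rule Liminf_le_Limsup) simp
    also have "\<dots> \<le> ennreal (2 * pi * \<tau> N)"
    proof (rule Limsup_bounded)
      show "\<forall>\<^sub>F k in sequentially. (\<integral>\<^sup>+t. ?v k t \<partial>lborel) \<le> ennreal (2 * pi * \<tau> N)"
        using eventually_ge_at_top[of N]
        by eventually_elim (rule diff_le, use K(3) order_trans in blast)
    qed
    finally show ?thesis .
  qed
  have f_int: "set_integrable lborel {0..2*pi} (\<lambda>t. (cmod (f t - S N t))\<^sup>2)"
    and f_int_le: "(LINT t:{0..2*pi}|lborel. (cmod (f t - S N t))\<^sup>2) \<le> 2 * pi * \<tau> N" for N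
  proof -
    have eq: "(\<integral>\<^sup>+t. ennreal (indicator {0..2*pi} t *\<^sub>R (cmod (f t - S N t))\<^sup>2) \<partial>lborel) =
       (\<integral>\<^sup>+t. ennreal ((cmod (f t - S N t))\<^sup>2) * indicator {0..2*pi} t \<partial>lborel)"
      by (intro nn_integral_cong) (auto split: split_indicator)
    show int: "set_integrable lborel {0..2*pi} (\<lambda>t. (cmod (f t - S N t))\<^sup>2)"
      unfolding set_integrable_def
    proof (rule integrableI_nonneg)
      show "(\<integral>\<^sup>+t. ennreal (indicator {0..2*pi} t *\<^sub>R (cmod (f t - S N t))\<^sup>2) \<partial>lborel) < \<infinity>"
        unfolding eq using f_le[of N] by (simp add: order_le_less_trans)
    qed auto
    have "ennreal (LINT t:{0..2*pi}|lborel. (cmod (f t - S N t))\<^sup>2) \<le> ennreal (2 * pi * \<tau> N)"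
      using nn_integral_eq_integral[OF int[unfolded set_integrable_def]] f_le[of N]
      unfolding set_lebesgue_integral_def eq by simp
    moreover have "\<tau> N \<ge> 0" using \<sigma>_le[of N] by (simp add: \<tau>_def)
    ultimately show "(LINT t:{0..2*pi}|lborel. (cmod (f t - S N t))\<^sup>2) \<le> 2 * pi * \<tau> N"
      by simp
  qed
  have "set_integrable lborel {0..2*pi} (\<lambda>t. (cmod (f t))\<^sup>2)"
  proof (rule set_integrable_bound)
    have "set_integrable lborel {0..2*pi} (\<lambda>t. (cmod (S 0 t))\<^sup>2)"
      unfolding S_def by (intro borel_integrable_atLeastAtMost' continuous_intros partial_exp_sum_continuous)
    thus "set_integrable lborel {0..2*pi} (\<lambda>t. 2 * (cmod (f t - S 0 t))\<^sup>2 + 2 * (cmod (S 0 t))\<^sup>2)"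
      using f_int[of 0] by (intro set_integral_add(1) set_integrable_mult_right) auto
    show "set_borel_measurable lborel {0..2*pi} (\<lambda>t. (cmod (f t))\<^sup>2)"
      unfolding set_borel_measurable_def by measurable
    show "AE t in lborel. t \<in> {0..2*pi} \<longrightarrow> norm ((cmod (f t))\<^sup>2) \<le>
        norm (2 * (cmod (f t - S 0 t))\<^sup>2 + 2 * (cmod (S 0 t))\<^sup>2)"
    proof (intro AE_I2 impI)
      fix t
      have "cmod (f t) \<le> cmod (f t - S 0 t) + cmod (S 0 t)"
        using norm_triangle_ineq[of "f t - S 0 t" "S 0 t"] by simp
      hence "(cmod (f t))\<^sup>2 \<le> (cmod (f t - S 0 t) + cmod (S 0 t))\<^sup>2" by (intro power_mono) auto
      also have "\<dots> \<le> 2 * (cmod (f t - S 0 t))\<^sup>2 + 2 * (cmod (S 0 t))\<^sup>2"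
        using sum_squares_bound[of "cmod (f t - S 0 t)" "cmod (S 0 t)"] by (simp add: power2_sum)
      finally show "norm ((cmod (f t))\<^sup>2) \<le> norm (2 * (cmod (f t - S 0 t))\<^sup>2 + 2 * (cmod (S 0 t))\<^sup>2)"
        by simp
    qed
  qed
  moreover have "(\<lambda>N. LINT t:{0..2*pi}|lborel. (cmod (f t - S N t))\<^sup>2) \<longlonglongrightarrow> 0"
  proof (rule tendsto_sandwich[OF _ _ tendsto_const])
    show "(\<lambda>N. 2 * pi * \<tau> N) \<longlonglongrightarrow> 0" using tendsto_mult_left[OF \<tau>0] by simp
    show "\<forall>\<^sub>F N in sequentially. (LINT t:{0..2*pi}|lborel. (cmod (f t - S N t))\<^sup>2) \<le> 2 * pi * \<tau> N"
      by (simp add: f_int_le)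
    show "\<forall>\<^sub>F N in sequentially. 0 \<le> (LINT t:{0..2*pi}|lborel. (cmod (f t - S N t))\<^sup>2)"
      by (simp add: set_lebesgue_integral_def)
  qed
  ultimately show ?thesis
    unfolding is_L2_sum_def S_def by (intro exI[of _ f]) auto
qed

text \<open>Partial sums and limit are compared through a triangle inequality with weights 1 +
  \<epsilon> and 1 + 1 / \<epsilon>. For fixed \<epsilon> the error term vanishes with growing
  \<open>N\<close>, and then \<epsilon> tends to 0.\<close>

lemma L2_sum_lower_bound:
  assumes summ: "(\<lambda>\<gamma>. (cmod (a \<gamma>))\<^sup>2) summable_on \<Gamma>" and f: "is_L2_sum \<Gamma> a f"
    and \<Omega>: "\<Omega> \<in> sets borel" "\<Omega> \<subseteq> {0..2*pi}"
    and le: "\<And>N. c * (\<Sum>\<gamma>\<in>{\<gamma>\<in>\<Gamma>. \<bar>\<gamma>\<bar> \<le> int N}. (cmod (a \<gamma>))\<^sup>2) \<le> L2_norm_sq_on \<Omega> (partial_exp_sum \<Gamma> a N)"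
  shows "c * (\<Sum>\<^sub>\<infinity>\<gamma>\<in>\<Gamma>. (cmod (a \<gamma>))\<^sup>2) \<le> L2_norm_sq_on \<Omega> f"
proof -
  define S where "S = partial_exp_sum \<Gamma> a"
  define I where "I = (LINT t:\<Omega>|lborel. (cmod (f t))\<^sup>2)"
  define \<delta> where "\<delta> N = (LINT t:{0..2*pi}|lborel. (cmod (f t - S N t))\<^sup>2)" for N
  have S_meas [measurable]: "S N \<in> borel_measurable borel" for N by (simp add: S_def)
  have f_meas [measurable]: "f \<in> borel_measurable borel" and f_int: "set_integrable lborel {0..2*pi} (\<lambda>t. (cmod (f t))\<^sup>2)"
    and \<delta>: "\<delta> \<longlonglongrightarrow> 0"
    using f by (auto simp: is_L2_sum_def S_def \<delta>_def[abs_def])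
  have S_int: "set_integrable lborel {0..2*pi} (\<lambda>t. (cmod (S N t))\<^sup>2)" for N
    unfolding S_def by (intro borel_integrable_atLeastAtMost' continuous_intros partial_exp_sum_continuous)
  have d_int: "set_integrable lborel {0..2*pi} (\<lambda>t. (cmod (f t - S N t))\<^sup>2)" for N
  proof (rule set_integrable_bound)
    show "set_integrable lborel {0..2*pi} (\<lambda>t. 2 * (cmod (f t))\<^sup>2 + 2 * (cmod (S N t))\<^sup>2)"
      using f_int S_int[of N] by (intro set_integral_add(1) set_integrable_mult_right) auto
    show "set_borel_measurable lborel {0..2*pi} (\<lambda>t. (cmod (f t - S N t))\<^sup>2)"
      unfolding set_borel_measurable_def by measurable
    show "AE t in lborel. t \<in> {0..2*pi} \<longrightarrow> norm ((cmod (f t - S N t))\<^sup>2) \<le>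
        norm (2 * (cmod (f t))\<^sup>2 + 2 * (cmod (S N t))\<^sup>2)"
    proof (intro AE_I2 impI)
      fix t
      have "(cmod (f t - S N t))\<^sup>2 \<le> (cmod (f t) + cmod (S N t))\<^sup>2"
        by (intro power_mono norm_triangle_ineq4) auto
      also have "\<dots> \<le> 2 * (cmod (f t))\<^sup>2 + 2 * (cmod (S N t))\<^sup>2"
        using sum_squares_bound[of "cmod (f t)" "cmod (S N t)"] by (simp add: power2_sum)
      finally show "norm ((cmod (f t - S N t))\<^sup>2) \<le> norm (2 * (cmod (f t))\<^sup>2 + 2 * (cmod (S N t))\<^sup>2)"
        by simp
    qed
  qed
  have sub: "set_integrable lborel \<Omega> g" if "set_integrable lborel {0..2*pi} g" for g :: "real \<Rightarrow> real"
    using set_integrable_subset[OF that _ \<Omega>(2)] \<Omega>(1) by simp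
  have I0: "I \<ge> 0" unfolding I_def set_lebesgue_integral_def by simp
  have bound: "(LINT t:\<Omega>|lborel. (cmod (S N t))\<^sup>2) \<le> (1 + \<epsilon>) * I + (1 + 1 / \<epsilon>) * \<delta> N" if \<epsilon>: "\<epsilon> > 0" for N \<epsilon>
  proof -
    have pw: "(cmod (S N t))\<^sup>2 \<le> (1 + \<epsilon>) * (cmod (f t))\<^sup>2 + (1 + 1 / \<epsilon>) * (cmod (f t - S N t))\<^sup>2" for t
    proof -
      define x y where "x = cmod (f t)" and "y = cmod (f t - S N t)"
      have "cmod (S N t) \<le> x + y"
        using norm_triangle_ineq4[of "f t" "f t - S N t"] by (simp add: x_def y_def)
      hence "(cmod (S N t))\<^sup>2 \<le> (x + y)\<^sup>2" by (intro power_mono) auto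
      \<comment> \<open>The mixed term 2 x y is absorbed by completing the square of \<epsilon> x -
        y.\<close>
      also have "\<dots> = (1 + \<epsilon>) * x\<^sup>2 + (1 + 1 / \<epsilon>) * y\<^sup>2 - (\<epsilon> * x - y)\<^sup>2 / \<epsilon>"
        using \<epsilon> by (simp add: field_simps power2_eq_square)
      also have "\<dots> \<le> (1 + \<epsilon>) * x\<^sup>2 + (1 + 1 / \<epsilon>) * y\<^sup>2" using \<epsilon> by simp
      finally show ?thesis by (simp add: x_def y_def)
    qed
    have "(LINT t:\<Omega>|lborel. (cmod (S N t))\<^sup>2) \<le>
        (LINT t:\<Omega>|lborel. (1 + \<epsilon>) * (cmod (f t))\<^sup>2 + (1 + 1 / \<epsilon>) * (cmod (f t - S N t))\<^sup>2)"
      by (intro set_integral_mono set_integral_add(1) set_integrable_mult_right sub S_int f_int d_int pw)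
    also have "\<dots> = (1 + \<epsilon>) * I + (1 + 1 / \<epsilon>) * (LINT t:\<Omega>|lborel. (cmod (f t - S N t))\<^sup>2)"
      unfolding I_def
      by (subst set_integral_add(2)) (auto intro!: sub f_int d_int)
    also have "(LINT t:\<Omega>|lborel. (cmod (f t - S N t))\<^sup>2) \<le> \<delta> N"
      unfolding \<delta>_def set_lebesgue_integral_def
      using sub[OF d_int[of N]] d_int[of N] \<Omega>(2)
      by (intro integral_mono) (auto simp: set_integrable_def split: split_indicator)
    finally show ?thesis using \<epsilon> by (simp add: mult_left_mono)
  qed
  define X where "X = 2 * pi * (c * (\<Sum>\<^sub>\<infinity>\<gamma>\<in>\<Gamma>. (cmod (a \<gamma>))\<^sup>2))"
  have X_le: "X \<le> (1 + \<epsilon>) * I" if \<epsilon>: "\<epsilon> > 0" for \<epsilon>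
  proof (rule LIMSEQ_le)
    show "(\<lambda>N. 2 * pi * (c * (\<Sum>\<gamma>\<in>{\<gamma>\<in>\<Gamma>. \<bar>\<gamma>\<bar> \<le> int N}. (cmod (a \<gamma>))\<^sup>2))) \<longlonglongrightarrow> X"
      unfolding X_def by (intro tendsto_mult tendsto_const window_sum_tendsto summ)
    show "(\<lambda>N. (1 + \<epsilon>) * I + (1 + 1 / \<epsilon>) * \<delta> N) \<longlonglongrightarrow> (1 + \<epsilon>) * I"
      using tendsto_add[OF tendsto_const tendsto_mult[OF tendsto_const \<delta>], of "(1 + \<epsilon>) * I" "1 + 1 / \<epsilon>"] by simp
    have "2 * pi * (c * (\<Sum>\<gamma>\<in>{\<gamma>\<in>\<Gamma>. \<bar>\<gamma>\<bar> \<le> int N}. (cmod (a \<gamma>))\<^sup>2)) \<le> (1 + \<epsilon>) * I + (1 + 1 / \<epsilon>) * \<delta> N" for N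
      using le[of N] bound[OF \<epsilon>, of N] by (simp add: L2_norm_sq_on_def S_def field_simps)
    thus "\<exists>M. \<forall>N\<ge>M. 2 * pi * (c * (\<Sum>\<gamma>\<in>{\<gamma>\<in>\<Gamma>. \<bar>\<gamma>\<bar> \<le> int N}. (cmod (a \<gamma>))\<^sup>2)) \<le> (1 + \<epsilon>) * I + (1 + 1 / \<epsilon>) * \<delta> N"
      by blast
  qed
  have "X \<le> I"
  proof (rule field_le_epsilon)
    fix e :: real assume "e > 0"
    \<comment> \<open>The denominator \<open>I + 1\<close> keeps the choice meaningful when
      \<open>I = 0\<close>.\<close>
    hence "X \<le> (1 + e / (I + 1)) * I" using I0 by (intro X_le) auto
    also have "\<dots> \<le> I + e" using I0 \<open>e > 0\<close> by (simp add: field_simps)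
    finally show "X \<le> I + e" .
  qed
  thus ?thesis by (simp add: X_def I_def L2_norm_sq_on_def field_simps)
qed

subsection \<open>Periodic frequency sets\<close>

lemma cell_iff_floor:
  assumes "h > 0"
  shows "t \<in> {h * real j..<h * real (Suc j)} \<longleftrightarrow> \<lfloor>t / h\<rfloor> = int j"
  using assms by (auto simp: floor_eq_iff field_simps)

lemma disjoint_cells: "h > 0 \<Longrightarrow> disjoint_family_on (\<lambda>j. {h * real j..<h * real (Suc j)}) J"
  unfolding disjoint_family_on_def disjoint_iff by (simp only: cell_iff_floor) auto

lemma cell_set_integrable:
  assumes "continuous_on UNIV (g :: real \<Rightarrow> real)"
  shows "set_integrable lborel {a..<b} g"
  by (rule set_integrable_subset[of _ "{a..b}"])
    (auto intro!: borel_integrable_atLeastAtMost' continuous_on_subset[OF assms])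

lemma set_integral_cells:
  assumes "h > 0" "finite J" "continuous_on UNIV (g :: real \<Rightarrow> real)"
  shows "set_integrable lborel (\<Union>j\<in>J. {h * real j..<h * real (Suc j)}) g"
    and "(LINT t:(\<Union>j\<in>J. {h * real j..<h * real (Suc j)})|lborel. g t) =
      (\<Sum>j\<in>J. LINT t:{h * real j..<h * real (Suc j)}|lborel. g t)"
proof -
  note ind = indicator_UN_disjoint[OF assms(2) disjoint_cells[OF assms(1)]]
  note int = cell_set_integrable[OF assms(3), unfolded set_integrable_def]
  show "set_integrable lborel (\<Union>j\<in>J. {h * real j..<h * real (Suc j)}) g"
    unfolding set_integrable_def ind scaleR_sum_left by (intro Bochner_Integration.integrable_sum int)
  show "(LINT t:(\<Union>j\<in>J. {h * real j..<h * real (Suc j)})|lborel. g t) =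
      (\<Sum>j\<in>J. LINT t:{h * real j..<h * real (Suc j)}|lborel. g t)"
    unfolding set_lebesgue_integral_def ind scaleR_sum_left
    by (intro Bochner_Integration.integral_sum int)
qed

lemma set_integral_cell_shift:
  fixes g :: "real \<Rightarrow> real"
  shows "(LINT t:{h * real j..<h * real (Suc j)}|lborel. g t) = (LINT t:{0..<h}|lborel. g (t + h * real j))"
proof -
  have "indicator {h * real j..<h * real (Suc j)} (h * real j + x) = (indicator {0..<h} x :: real)" for x
    by (auto simp: indicator_def algebra_simps)
  thus ?thesis
    unfolding set_lebesgue_integral_def
    by (subst lborel_integral_real_affine[of 1 _ "h * real j"]) (simp_all add: add.commute)
qed

lemma UN_cells:
  assumes "h > 0"
  shows "(\<Union>j<N. {h * real j..<h * real (Suc j)}) = {0..<h * real N}"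
proof (induction N)
  case (Suc N)
  have "{0..<h * real N} \<union> {h * real N..<h * real (Suc N)} = {0..<h * real (Suc N)}"
    using assms by (intro ivl_disj_un_two(3)) (auto simp: algebra_simps)
  thus ?case unfolding lessThan_Suc UN_insert Suc.IH by blast
qed simp

text \<open>Translating every cell onto the first one turns the integral over the period into the
  integral over \<open>{0..<h}\<close> of the sum over all shifts. The pointwise inequality can then
  be integrated, and nonnegativity of \<open>g\<close> allows the cells in \<open>J\<close> to be
  enlarged to \<open>\<Omega>\<close>.\<close>

lemma grid_lower_bound:
  fixes g :: "real \<Rightarrow> real"
  assumes "N > 0" and J: "J \<subseteq> {..<N}" and cont: "continuous_on UNIV g" and nonneg: "\<And>t. g t \<ge> 0"
    and sub: "\<And>j. j \<in> J \<Longrightarrow> {2 * pi / real N * real j..<2 * pi / real N * real (Suc j)} \<subseteq> \<Omega>"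
    and \<Omega>: "\<Omega> \<in> sets borel" "\<Omega> \<subseteq> {0..2*pi}"
    and pointwise: "\<And>t. c * (\<Sum>j<N. g (t + 2 * pi / real N * real j)) \<le> (\<Sum>j\<in>J. g (t + 2 * pi / real N * real j))"
  shows "c * (LINT t:{0..2*pi}|lborel. g t) \<le> (LINT t:\<Omega>|lborel. g t)"
proof -
  define h where "h = 2 * pi / real N"
  have h: "h > 0" "h * real N = 2 * pi" using assms(1) by (auto simp: h_def)
  have fin: "finite J" using J finite_subset by blast
  have shift: "set_integrable lborel {0..<h} (\<lambda>t. g (t + h * real j))" for j
    by (rule cell_set_integrable) (intro continuous_on_compose2[OF cont] continuous_intros, simp)
  \<comment> \<open>The half-open cells tile the period without its right endpoint, which is a null
    set.\<close>
  have full: "(LINT t:{0..2*pi}|lborel. g t) = (LINT t:{0..<2*pi}|lborel. g t)"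
    unfolding set_lebesgue_integral_def
  proof (rule integral_cong_AE)
    show "AE t in lborel. indicat_real {0..2*pi} t *\<^sub>R g t = indicat_real {0..<2*pi} t *\<^sub>R g t"
      using AE_lborel_singleton[of "2 * pi"] by eventually_elim (auto simp: indicator_def)
  qed (use borel_measurable_continuous_onI[OF cont] in measurable)
  have sum_eq: "(\<Sum>j\<in>I. LINT t:{h * real j..<h * real (Suc j)}|lborel. g t) =
      (LINT t:{0..<h}|lborel. (\<Sum>j\<in>I. g (t + h * real j)))" for I
    unfolding set_integral_cell_shift using shift
    by (simp add: set_lebesgue_integral_def set_integrable_def scaleR_sum_right Bochner_Integration.integral_sum sum_distrib_left)
  have "c * (LINT t:{0..2*pi}|lborel. g t) = c * (LINT t:{0..<h}|lborel. (\<Sum>j<N. g (t + h * real j)))"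
    unfolding sum_eq[symmetric] set_integral_cells(2)[OF h(1) finite_lessThan cont, symmetric]
      UN_cells[OF h(1)] h(2) full ..
  also have "\<dots> = (LINT t:{0..<h}|lborel. c * (\<Sum>j<N. g (t + h * real j)))" by simp
  also have "\<dots> \<le> (LINT t:{0..<h}|lborel. (\<Sum>j\<in>J. g (t + h * real j)))"
  proof (rule set_integral_mono)
    have sint: "set_integrable lborel {0..<h} (\<lambda>t. \<Sum>j\<in>I. g (t + h * real j))" for I
      using shift unfolding set_integrable_def scaleR_sum_right by (intro Bochner_Integration.integrable_sum)
    show "set_integrable lborel {0..<h} (\<lambda>t. \<Sum>j\<in>J. g (t + h * real j))" by (rule sint)
    show "set_integrable lborel {0..<h} (\<lambda>t. c * (\<Sum>j<N. g (t + h * real j)))"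
      by (intro set_integrable_mult_right sint)
  qed (use pointwise in \<open>auto simp: h_def\<close>)
  also have "\<dots> = (LINT t:(\<Union>j\<in>J. {h * real j..<h * real (Suc j)})|lborel. g t)"
    unfolding set_integral_cells(2)[OF h(1) fin cont] sum_eq ..
  also have "\<dots> \<le> (LINT t:\<Omega>|lborel. g t)"
    unfolding set_lebesgue_integral_def
  proof (rule integral_mono)
    show "integrable lborel (\<lambda>t. indicat_real (\<Union>j\<in>J. {h * real j..<h * real (Suc j)}) t *\<^sub>R g t)"
      using set_integral_cells(1)[OF h(1) fin cont] by (simp add: set_integrable_def)
    have "set_integrable lborel \<Omega> g"
      by (rule set_integrable_subset[OF _ _ \<Omega>(2)])
        (use \<Omega>(1) in \<open>auto intro!: borel_integrable_atLeastAtMost' continuous_on_subset[OF cont]\<close>)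
    thus "integrable lborel (\<lambda>t. indicat_real \<Omega> t *\<^sub>R g t)" by (simp add: set_integrable_def)
    show "indicat_real (\<Union>j\<in>J. {h * real j..<h * real (Suc j)}) t *\<^sub>R g t \<le> indicat_real \<Omega> t *\<^sub>R g t" for t
    proof -
      have "(\<Union>j\<in>J. {h * real j..<h * real (Suc j)}) \<subseteq> \<Omega>"
        using sub unfolding h_def[symmetric] by blast
      hence "indicat_real (\<Union>j\<in>J. {h * real j..<h * real (Suc j)}) t \<le> indicat_real \<Omega> t"
        unfolding indicator_def by (simp only: subset_iff split: if_split) simp
      thus ?thesis using nonneg by (intro scaleR_right_mono)
    qed
  qed
  finally show ?thesis .
qed

text \<open>A compact \<open>T\<close> inside \<open>\<Omega>\<close> of nearly full measure has an
  \<open>r\<close>-neighbourhood inside \<open>\<Omega>\<close>. Once the mesh is below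
  \<open>r\<close>, every cell meeting \<open>T\<close> lies in \<open>\<Omega>\<close>, and since
  these cells cover \<open>T\<close>, their number times the mesh bounds its measure.\<close>

lemma inner_grid_approximation:
  assumes "open \<Omega>" "\<Omega> \<subseteq> {0..2*pi}" "\<epsilon> > 0"
  shows "\<exists>N0. \<forall>N\<ge>N0. N > 0 \<longrightarrow> (\<exists>J\<subseteq>{..<N}. (nmeasure \<Omega> - \<epsilon>) * real N \<le> real (card J) \<and>
    (\<forall>j\<in>J. {2 * pi / real N * real j..2 * pi / real N * real (Suc j)} \<subseteq> \<Omega>))"
proof -
  have \<Omega>_lm: "\<Omega> \<in> lmeasurable"
    using assms by (meson bounded_closed_interval bounded_subset lmeasurable_open)
  obtain T where T: "closed T" "T \<subseteq> \<Omega>" "\<Omega> - T \<in> lmeasurable" "emeasure lebesgue (\<Omega> - T) < ennreal (2 * pi * \<epsilon>)"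
    using sets_lebesgue_inner_closed[of \<Omega> "2 * pi * \<epsilon>"] \<Omega>_lm assms(3) by auto
  have "compact T"
    using T(1,2) assms(2) by (meson bounded_closed_interval bounded_subset compact_eq_bounded_closed order_trans)
  then obtain r where r: "r > 0" "(\<Union>x\<in>T. ball x r) \<subseteq> \<Omega>"
    using compact_subset_open_imp_ball_epsilon_subset[of T \<Omega>] assms(1) T(2) by blast
  have T_lm: "T \<in> lmeasurable" using \<open>compact T\<close> by (rule lmeasurable_compact)
  have "measure lebesgue (\<Omega> - T) < 2 * pi * \<epsilon>"
    using T(3,4) assms(3) by (simp add: emeasure_eq_measure2 ennreal_less_iff)
  moreover have "measure lebesgue (\<Omega> - T) = measure lebesgue \<Omega> - measure lebesgue T"
    by (rule measurable_measure_Diff) (use \<Omega>_lm T_lm T(2) in auto)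
  moreover have "measure lebesgue \<Omega> = 2 * pi * nmeasure \<Omega>"
    using assms(1) by (simp add: nmeasure_def measure_completion)
  ultimately have mT: "2 * pi * (nmeasure \<Omega> - \<epsilon>) < measure lebesgue T"
    by (simp add: algebra_simps)
  obtain N0 :: nat where N0: "2 * pi / r < real N0" using reals_Archimedean2 by blast
  show ?thesis
  proof (intro exI[of _ N0] allI impI)
    fix N assume N: "N0 \<le> N" "0 < N"
    define h where "h = 2 * pi / real N"
    have h: "h > 0" "h * real N = 2 * pi" using N by (auto simp: h_def)
    have "2 * pi / r < real N" using N0 N(1) by linarith
    hence hr: "h < r" using r(1) N(2) by (simp add: h_def field_simps)
    define I where "I j = {h * real j..h * real (Suc j)}" for j
    define J where "J = {j. j < N \<and> I j \<inter> T \<noteq> {}}"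
    have I_sub: "I j \<subseteq> \<Omega>" if "j \<in> J" for j
    proof
      fix y assume y: "y \<in> I j"
      from that obtain x where x: "x \<in> I j" "x \<in> T" by (auto simp: J_def)
      have "dist x y \<le> h" using x(1) y by (auto simp: I_def dist_real_def algebra_simps abs_le_iff)
      hence "y \<in> ball x r" using hr by simp
      thus "y \<in> \<Omega>" using r(2) x(2) by blast
    qed
    have "T \<subseteq> (\<Union>j\<in>J. I j)"
    proof
      fix x assume x: "x \<in> T"
      hence x2: "0 \<le> x" "x \<le> h * real N" using T(2) assms(2) h(2) by (auto simp: subset_iff)
      \<comment> \<open>The right endpoint belongs to no half-open cell and is assigned to the last
        closed one.\<close>
      have "\<exists>j<N. x \<in> I j"
      proof (cases "x = h * real N")
        case True
        thus ?thesis using N(2) h(1) by (intro exI[of _ "N - 1"]) (auto simp: I_def of_nat_diff)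
      next
        case False
        hence "x \<in> {0..<h * real N}" using x2 by simp
        then obtain j where "j < N" "x \<in> {h * real j..<h * real (Suc j)}"
          unfolding UN_cells[OF h(1), symmetric] by auto
        thus ?thesis unfolding I_def by (intro exI[of _ j]) (simp del: of_nat_Suc)
      qed
      thus "x \<in> (\<Union>j\<in>J. I j)" using x by (auto simp: J_def)
    qed
    have "finite J" unfolding J_def by simp
    have "measure lebesgue T \<le> measure lebesgue (\<Union>j\<in>J. I j)"
      by (rule measure_mono_fmeasurable[OF \<open>T \<subseteq> (\<Union>j\<in>J. I j)\<close>])
        (use T_lm \<open>finite J\<close> in \<open>auto simp: I_def\<close>)
    also have "\<dots> \<le> (\<Sum>j\<in>J. measure lebesgue (I j))"
      by (rule measure_UNION_le[OF \<open>finite J\<close>]) (auto simp: I_def)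
    also have "\<dots> = real (card J) * h"
      using h(1) by (simp add: I_def algebra_simps)
    finally have "2 * pi * (nmeasure \<Omega> - \<epsilon>) \<le> real (card J) * h" using mT by linarith
    hence "2 * pi * (nmeasure \<Omega> - \<epsilon>) * real N \<le> real (card J) * h * real N"
      by (intro mult_right_mono) auto
    also have "\<dots> = 2 * pi * real (card J)" using h(2) by (simp add: mult.assoc)
    finally have "2 * pi * ((nmeasure \<Omega> - \<epsilon>) * real N) \<le> 2 * pi * real (card J)"
      by (simp only: mult.assoc)
    hence "(nmeasure \<Omega> - \<epsilon>) * real N \<le> real (card J)"
      by (rule mult_left_le_imp_le) simp
    with I_sub show "\<exists>J\<subseteq>{..<N}. (nmeasure \<Omega> - \<epsilon>) * real N \<le> real (card J) \<and>
        (\<forall>j\<in>J. {2 * pi / real N * real j..2 * pi / real N * real (Suc j)} \<subseteq> \<Omega>)"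
      unfolding h_def[symmetric] by (intro exI[of _ J]) (auto simp: J_def I_def simp del: of_nat_Suc)
  qed
qed

text \<open>Shifting by \<open>m\<close> cells multiplies the frequency \<open>\<gamma>\<close> by a
  phase that depends only on its residue modulo \<open>N\<close>. Grouping by residues shows that
  the values along the grid are a discrete Fourier transform of coefficients depending on
  \<open>t\<close>.\<close>

lemma trig_poly_shift:
  fixes a :: "int \<Rightarrow> complex" and e :: "nat \<Rightarrow> nat"
  assumes N: "N > 0" and inj: "inj_on e {..<k}" and G: "finite G"
    and res: "\<And>\<gamma>. \<gamma> \<in> G \<Longrightarrow> nat (\<gamma> mod int N) \<in> e ` {..<k}"
  shows "(\<Sum>\<gamma>\<in>G. a \<gamma> * exp (\<i> * of_int \<gamma> * of_real (t + 2 * pi / real N * real m))) =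
    (\<Sum>i<k. (\<Sum>\<gamma>\<in>{\<gamma>\<in>G. nat (\<gamma> mod int N) = e i}. a \<gamma> * exp (\<i> * of_int \<gamma> * of_real t)) *
      cis (2 * pi * real m / real N * real (e i)))"
proof -
  have shift: "exp (\<i> * of_int \<gamma> * of_real (t + 2 * pi / real N * real m)) =
      exp (\<i> * of_int \<gamma> * of_real t) * cis (2 * pi * real m / real N * real (nat (\<gamma> mod int N)))" for \<gamma>
  proof -
    define r z where "r = nat (\<gamma> mod int N)" and "z = \<gamma> div int N"
    have "\<gamma> = int N * z + int r" using N by (simp add: r_def z_def)
    hence "real_of_int \<gamma> = real N * real_of_int z + real r" by simp
    hence "real_of_int \<gamma> * (2 * pi / real N * real m) =
        2 * pi * real m / real N * real r + 2 * pi * real_of_int (z * int m)"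
      using N by (simp add: field_simps)
    hence "cis (real_of_int \<gamma> * (2 * pi / real N * real m)) =
        cis (2 * pi * real m / real N * real r) * cis (2 * pi * real_of_int (z * int m))"
      by (simp only: cis_mult)
    also have "cis (2 * pi * real_of_int (z * int m)) = 1"
      by (rule cis_multiple_2pi) simp
    finally have "cis (real_of_int \<gamma> * (2 * pi / real N * real m)) = cis (2 * pi * real m / real N * real r)"
      by simp
    moreover have "exp (\<i> * of_int \<gamma> * of_real (t + 2 * pi / real N * real m)) =
        exp (\<i> * of_int \<gamma> * of_real t) * cis (real_of_int \<gamma> * (2 * pi / real N * real m))"
      unfolding cis_conv_exp exp_add[symmetric] by (rule arg_cong[of _ _ exp]) (simp add: algebra_simps)
    ultimately show ?thesis by (simp add: r_def)
  qed
  define F where "F \<gamma> = a \<gamma> * exp (\<i> * of_int \<gamma> * of_real t) *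
      cis (2 * pi * real m / real N * real (nat (\<gamma> mod int N)))" for \<gamma>
  have "(\<Sum>\<gamma>\<in>G. a \<gamma> * exp (\<i> * of_int \<gamma> * of_real (t + 2 * pi / real N * real m))) = sum F G"
    unfolding shift F_def by (simp only: mult.assoc)
  also have "\<dots> = (\<Sum>r\<in>e ` {..<k}. \<Sum>\<gamma>\<in>{\<gamma>\<in>G. nat (\<gamma> mod int N) = r}. F \<gamma>)"
    using G res by (intro sum.group[symmetric]) auto
  also have "\<dots> = (\<Sum>i<k. \<Sum>\<gamma>\<in>{\<gamma>\<in>G. nat (\<gamma> mod int N) = e i}. F \<gamma>)"
    using inj by (simp add: sum.reindex)
  finally show ?thesis
    by (simp add: F_def sum_distrib_right)
qed

text \<open>For each fixed \<open>t\<close> the matrix bound is applied to the vector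
  \<open>x t\<close> of residue-class sums. \<open>dft_parseval\<close> rewrites its norm as a sum
  over all \<open>N\<close> shifts, which makes the bound the pointwise hypothesis of
  \<open>grid_lower_bound\<close>.\<close>

lemma trig_poly_lower_bound:
  fixes a :: "int \<Rightarrow> complex"
  assumes N: "N > 0" and J: "J \<subseteq> {..<N}"
    and e: "inj_on e {..<k}" "e ` {..<k} \<subseteq> {..<N}"
    and dft: "\<And>x. c * norm_sq_upto k x \<le>
      (\<Sum>m\<in>J. (cmod (\<Sum>i<k. x i * cis (2 * pi * real m / real N * real (e i))))\<^sup>2) / real N"
    and sub: "\<And>j. j \<in> J \<Longrightarrow> {2 * pi / real N * real j..<2 * pi / real N * real (Suc j)} \<subseteq> \<Omega>"
    and \<Omega>: "\<Omega> \<in> sets borel" "\<Omega> \<subseteq> {0..2*pi}"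
    and G: "finite G" "\<And>\<gamma>. \<gamma> \<in> G \<Longrightarrow> nat (\<gamma> mod int N) \<in> e ` {..<k}"
  shows "c * (\<Sum>\<gamma>\<in>G. (cmod (a \<gamma>))\<^sup>2) \<le>
    L2_norm_sq_on \<Omega> (\<lambda>t. \<Sum>\<gamma>\<in>G. a \<gamma> * exp (\<i> * of_int \<gamma> * of_real t))"
proof -
  define T where "T t = (\<Sum>\<gamma>\<in>G. a \<gamma> * exp (\<i> * of_int \<gamma> * of_real t))" for t :: real
  define x where "x t i = (\<Sum>\<gamma>\<in>{\<gamma>\<in>G. nat (\<gamma> mod int N) = e i}. a \<gamma> * exp (\<i> * of_int \<gamma> * of_real t))"
    for t :: real and i
  have T: "T (t + 2 * pi / real N * real m) = (\<Sum>i<k. x t i * cis (2 * pi * real m / real N * real (e i)))" for t m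
    unfolding T_def x_def by (rule trig_poly_shift[OF N e(1) G])
  have "c * (LINT t:{0..2*pi}|lborel. (cmod (T t))\<^sup>2) \<le> (LINT t:\<Omega>|lborel. (cmod (T t))\<^sup>2)"
  proof (rule grid_lower_bound[OF N J _ _ sub \<Omega>])
    show "continuous_on UNIV (\<lambda>t. (cmod (T t))\<^sup>2)"
      unfolding T_def by (intro continuous_intros)
    show "c * (\<Sum>j<N. (cmod (T (t + 2 * pi / real N * real j)))\<^sup>2) \<le>
        (\<Sum>j\<in>J. (cmod (T (t + 2 * pi / real N * real j)))\<^sup>2)" for t
      unfolding T dft_parseval[OF e] using dft[of "x t"] N by (simp add: field_simps)
  qed auto
  moreover have "(LINT t:{0..2*pi}|lborel. (cmod (T t))\<^sup>2) = 2 * pi * (\<Sum>\<gamma>\<in>G. (cmod (a \<gamma>))\<^sup>2)"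
    unfolding T_def by (rule trig_poly_norm_sq[OF G(1)])
  ultimately show ?thesis
    unfolding L2_norm_sq_on_def T_def by (simp add: field_simps)
qed

section \<open>Positive measure of the set and the choice of the parameters\<close>

lemma nmeasure_pos:
  assumes "open \<Omega>" "\<Omega> \<noteq> {}" "\<Omega> \<subseteq> {0..2*pi}"
  shows "nmeasure \<Omega> > 0"
proof -
  have "\<Omega> \<in> lmeasurable"
    using assms by (meson bounded_closed_interval bounded_subset lmeasurable_open)
  hence "measure lebesgue \<Omega> \<noteq> 0"
    using open_not_negligible[OF assms(1,2)] by (simp add: negligible_iff_measure)
  thus ?thesis using assms(1)
    by (simp add: nmeasure_def measure_completion zero_less_measure_iff)
qed

theorem theorem5:
  fixes d :: real
  assumes "0 < d" "d < 1"
  shows "\<forall>\<Omega> :: real set. open \<Omega> \<and> \<Omega> \<noteq> {} \<and> \<Omega> \<subseteq> {0..2*pi} \<longrightarrow>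
    (\<exists>\<Gamma> :: int set. \<exists>D. has_uniform_density \<Gamma> D \<and> D > (1 - d) * nmeasure \<Omega> \<and>
      (\<forall>a :: int \<Rightarrow> complex. (\<lambda>\<gamma>. (cmod (a \<gamma>))\<^sup>2) summable_on \<Gamma> \<longrightarrow>
         (\<exists>f. is_L2_sum \<Gamma> a f) \<and>
         (\<forall>f. is_L2_sum \<Gamma> a f \<longrightarrow>
            (1 - sqrt (1 - d))\<^sup>2 * nmeasure \<Omega> * (\<Sum>\<^sub>\<infinity>\<gamma>\<in>\<Gamma>. (cmod (a \<gamma>))\<^sup>2)
              \<le> L2_norm_sq_on \<Omega> f)))"
proof (intro allI impI)
  fix \<Omega> :: "real set"
  assume "open \<Omega> \<and> \<Omega> \<noteq> {} \<and> \<Omega> \<subseteq> {0..2*pi}"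
  hence \<Omega>: "open \<Omega>" "\<Omega> \<noteq> {}" "\<Omega> \<subseteq> {0..2*pi}" by auto
  define w where "w = nmeasure \<Omega>"
  have w: "w > 0" unfolding w_def by (rule nmeasure_pos[OF \<Omega>])
  define q where "q = sqrt (1 - d)"
  have q: "0 < q" "q < 1" and q2: "q\<^sup>2 = 1 - d" using assms by (auto simp: q_def)
  \<comment> \<open>The largest error for which the inequality \<open>gap\<close> below still holds.\<close>
  define \<epsilon> where "\<epsilon> = q\<^sup>2 * (1 - q) * w\<^sup>2 / (1 + q + q\<^sup>2 * (1 - q) * w)"
  have den: "1 + q + q\<^sup>2 * (1 - q) * w > 0" using q w by (intro add_pos_pos mult_pos_pos) auto
  have \<epsilon>: "\<epsilon> > 0" "\<epsilon> * (1 + q + q\<^sup>2 * (1 - q) * w) = q\<^sup>2 * (1 - q) * w\<^sup>2"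
    using q w den by (auto simp: \<epsilon>_def)
  obtain N0 where N0: "\<And>N. N \<ge> N0 \<Longrightarrow> N > 0 \<Longrightarrow> \<exists>J\<subseteq>{..<N}. (w - \<epsilon>) * real N \<le> real (card J) \<and>
    (\<forall>j\<in>J. {2 * pi / real N * real j..2 * pi / real N * real (Suc j)} \<subseteq> \<Omega>)"
    using inner_grid_approximation[OF \<Omega>(1,3) \<epsilon>(1)] unfolding w_def by blast
  obtain N1 :: nat where N1: "1 / \<epsilon> < real N1" using reals_Archimedean2 by blast
  \<comment> \<open>\<open>N0\<close> provides the grid approximation, and \<open>N1\<close> makes
    the rounding error 1 in \<open>k\<close> at most \<open>\<epsilon> * N\<close>.\<close>
  define N where "N = max N0 N1"
  have "real N1 \<le> real N" by (simp add: N_def)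
  hence N\<epsilon>: "1 / \<epsilon> < real N" using N1 by linarith
  hence "real N > 0" using \<epsilon>(1) by (meson less_trans zero_less_divide_1_iff)
  hence N: "N > 0" "N \<ge> N0" by (auto simp: N_def)
  have N1': "1 \<le> \<epsilon> * real N" using N\<epsilon> \<epsilon>(1) by (simp add: field_simps)
  obtain J where J: "J \<subseteq> {..<N}" "(w - \<epsilon>) * real N \<le> real (card J)"
    and J_sub: "\<And>j. j \<in> J \<Longrightarrow> {2 * pi / real N * real j..2 * pi / real N * real (Suc j)} \<subseteq> \<Omega>"
    using N0[OF N(2,1)] by blast
  define n where "n = card J"
  have nN: "n \<le> N" using card_mono[OF finite_lessThan J(1)] by (simp add: n_def)
  \<comment> \<open>The least integer strictly above \<open>q\<^sup>2 * w * N\<close>: strictness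
    gives the strict density bound, minimality keeps the deletion estimate strong.\<close>
  define k where "k = Suc (nat \<lfloor>q\<^sup>2 * w * real N\<rfloor>)"
  have k0: "0 \<le> q\<^sup>2 * w * real N" using w by simp
  have "real k = of_int \<lfloor>q\<^sup>2 * w * real N\<rfloor> + 1" using k0 by (simp add: k_def)
  hence k: "q\<^sup>2 * w * real N < real k" "real k \<le> q\<^sup>2 * w * real N + 1" by linarith+
  \<comment> \<open>This is the inequality \<open>(1 - q)\<^sup>2 * w \<le> c\<close> with
    denominators cleared. The losses from \<open>n \<ge> (w - \<epsilon>) * N\<close> and from
    rounding \<open>k\<close> use up exactly the surplus q^2 (1 - q) w^2 N, by the defining equation
    of \<open>\<epsilon>\<close>.\<close>
  have gap: "q * (1 - q) * w * (real N - q * real n) \<le> q * real n - real k"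
  proof -
    have "real k \<le> (q\<^sup>2 * w + \<epsilon>) * real N" using k(2) N1' by (simp add: algebra_simps)
    moreover have "q * (1 + q * (1 - q) * w) * ((w - \<epsilon>) * real N) \<le> q * (1 + q * (1 - q) * w) * real n"
      using J(2) q w unfolding n_def by (intro mult_left_mono) auto
    moreover have "q * (1 + q * (1 - q) * w) * ((w - \<epsilon>) * real N) - (q\<^sup>2 * w + \<epsilon>) * real N
        - q * (1 - q) * w * real N
        = (q\<^sup>2 * (1 - q) * w\<^sup>2 - \<epsilon> * (1 + q + q\<^sup>2 * (1 - q) * w)) * real N"
      by (simp add: algebra_simps power2_eq_square)
    ultimately have "q * (1 - q) * w * real N \<le> q * (1 + q * (1 - q) * w) * real n - real k"
      unfolding \<epsilon>(2) by simp
    thus ?thesis by (simp add: algebra_simps power2_eq_square)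
  qed
  have pos: "real N - q * real n > 0"
  proof -
    have "q * real n \<le> q * real N" using nN q by simp
    also have "\<dots> < real N" using q N by simp
    finally show ?thesis by simp
  qed
  \<comment> \<open>The left side of \<open>gap\<close> is nonnegative, so \<open>k\<close> is at
    most \<open>q * n\<close>, which is below \<open>N\<close>.\<close>
  have kN: "k \<le> N"
  proof -
    have "0 \<le> q * (1 - q) * w * (real N - q * real n)" using q w pos by simp
    with gap have "real k \<le> q * real n" by linarith
    with pos show ?thesis by linarith
  qed
  define c where "c = (1 - q) / q * ((q * real n - real k) / (real N - q * real n))"
  have c: "(1 - q)\<^sup>2 * w \<le> c"
  proof -
    have "q * (1 - q) * w \<le> (q * real n - real k) / (real N - q * real n)"
      using gap pos by (simp add: pos_le_divide_eq)
    hence "(1 - q) / q * (q * (1 - q) * w) \<le> c"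
      unfolding c_def using q by (intro mult_left_mono) auto
    thus ?thesis using q by (simp add: power2_eq_square)
  qed
  obtain e where e: "inj_on e {..<k}" "e ` {..<k} \<subseteq> {..<N}"
    and dft: "\<And>x. c * norm_sq_upto k x \<le>
      (\<Sum>m\<in>J. (cmod (\<Sum>i<k. x i * cis (2 * pi * real m / real N * real (e i))))\<^sup>2) / real N"
    using dft_restricted_invertibility[OF q J(1), of k] kN unfolding c_def n_def k_def by blast
  define \<Gamma> where "\<Gamma> = {\<gamma>. nat (\<gamma> mod int N) \<in> e ` {..<k}}"
  have dens: "has_uniform_density \<Gamma> (real k / real N)"
    using residues_uniform_density[OF N(1) e(2)] e(1) by (simp add: \<Gamma>_def card_image)
  have "(1 - d) * nmeasure \<Omega> < real k / real N"
    using k(1) N(1) unfolding q2 w_def by (simp add: field_simps)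
  moreover have "(\<exists>f. is_L2_sum \<Gamma> a f) \<and> (\<forall>f. is_L2_sum \<Gamma> a f \<longrightarrow>
      (1 - sqrt (1 - d))\<^sup>2 * nmeasure \<Omega> * (\<Sum>\<^sub>\<infinity>\<gamma>\<in>\<Gamma>. (cmod (a \<gamma>))\<^sup>2) \<le> L2_norm_sq_on \<Omega> f)"
    if summ: "(\<lambda>\<gamma>. (cmod (a \<gamma>))\<^sup>2) summable_on \<Gamma>" for a :: "int \<Rightarrow> complex"
  proof (intro conjI allI impI)
    show "\<exists>f. is_L2_sum \<Gamma> a f" by (rule L2_sum_exists[OF summ])
    fix f assume f: "is_L2_sum \<Gamma> a f"
    have "c * (\<Sum>\<gamma>\<in>{\<gamma>\<in>\<Gamma>. \<bar>\<gamma>\<bar> \<le> int M}. (cmod (a \<gamma>))\<^sup>2) \<le> L2_norm_sq_on \<Omega> (partial_exp_sum \<Gamma> a M)" for M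
      unfolding partial_exp_sum_def[abs_def]
    proof (rule trig_poly_lower_bound[OF N(1) J(1) e dft])
      show "{2 * pi / real N * real j..<2 * pi / real N * real (Suc j)} \<subseteq> \<Omega>" if "j \<in> J" for j
        by (rule order_trans[OF _ J_sub[OF that]]) auto
      show "finite {\<gamma>\<in>\<Gamma>. \<bar>\<gamma>\<bar> \<le> int M}" by (rule finite_window)
    qed (use \<Omega> in \<open>auto simp: \<Gamma>_def\<close>)
    from L2_sum_lower_bound[OF summ f _ \<Omega>(3) this] \<Omega>(1)
    have "c * (\<Sum>\<^sub>\<infinity>\<gamma>\<in>\<Gamma>. (cmod (a \<gamma>))\<^sup>2) \<le> L2_norm_sq_on \<Omega> f" by simp
    moreover have "(1 - q)\<^sup>2 * w * (\<Sum>\<^sub>\<infinity>\<gamma>\<in>\<Gamma>. (cmod (a \<gamma>))\<^sup>2) \<le> c * (\<Sum>\<^sub>\<infinity>\<gamma>\<in>\<Gamma>. (cmod (a \<gamma>))\<^sup>2)"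
      using c by (intro mult_right_mono infsum_nonneg) auto
    ultimately show "(1 - sqrt (1 - d))\<^sup>2 * nmeasure \<Omega> * (\<Sum>\<^sub>\<infinity>\<gamma>\<in>\<Gamma>. (cmod (a \<gamma>))\<^sup>2) \<le> L2_norm_sq_on \<Omega> f"
      unfolding q_def[symmetric] w_def[symmetric] by linarith
  qed
  ultimately show "\<exists>\<Gamma> :: int set. \<exists>D. has_uniform_density \<Gamma> D \<and> D > (1 - d) * nmeasure \<Omega> \<and>
      (\<forall>a :: int \<Rightarrow> complex. (\<lambda>\<gamma>. (cmod (a \<gamma>))\<^sup>2) summable_on \<Gamma> \<longrightarrow>
         (\<exists>f. is_L2_sum \<Gamma> a f) \<and>
         (\<forall>f. is_L2_sum \<Gamma> a f \<longrightarrow>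
            (1 - sqrt (1 - d))\<^sup>2 * nmeasure \<Omega> * (\<Sum>\<^sub>\<infinity>\<gamma>\<in>\<Gamma>. (cmod (a \<gamma>))\<^sup>2)
              \<le> L2_norm_sq_on \<Omega> f))"
    using dens by blast
qed

end
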